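(* Let $\mathcal{X},\mathcal{Y}$ be real Hilbert spaces, $f:\mathcal{X}\to\mathbb{R}$ convex and continuously differentiable, $A:\mathcal{X}\to\mathcal{Y}$ a continuous linear operator, $b\in\mathcal{Y}$, and suppose that the primal-dual solution set $\Omega$ of $\min\{f(x):Ax=b\}$ is nonempty. Let $t_0>0$, $\alpha>0$, $\theta>\frac1\alpha$, $0\le q<1$, $0<p<1-q$, $c>0$, and let $s\in\mathbb{R}$ satisfy $p-2q<s<1-3q$. Let $(x(t),\lambda(t))$, $t\ge t_0$, be a solution of $$\begin{cases}\ddot{x}(t)+\frac{\alpha}{t^q}\dot{x}(t)+t^s\left(\nabla f(x(t))+A^T\lambda(t)+\frac{c}{t^p}x(t)\right)=0,\\ \dot{\lambda}(t)-t^{q+s}\left(A(x(t)+\theta t^q\dot{x}(t))-b-\frac{c}{t^p}\lambda(t)\right)=0,\end{cases}\qquad t\ge t_0,$$ and let $(x^*,\lambda^* )$ be the minimum norm element of $\Omega$. Then, as $t\to+\infty$, $$\|x(t)-x_t\|^2\le\mathcal{O}\left(\frac{1}{t^{1-(p+q)}}\right),\quad \mathcal{L}(x(t),\lambda^* )-\mathcal{L}(x^*,\lambda^* )\le\mathcal{O}\left(\frac{1}{t^{p}}+\frac{1}{t^{(1-(p+q))/2}}\right),$$ $$|f(x(t))-f(x^* )|\le\mathcal{O}\left(\frac{1}{t^{p}}+\frac{1}{t^{(1-(p+q))/2}}\right),\quad \|Ax(t)-b\|\le\mathcal{O}\left(\frac{1}{t^{p}}+\frac{1}{t^{(1-(p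+q))/2}}\right).$$
   Context: $\|(x,\lambda)\|=\sqrt{\|x\|^2+\|\lambda\|^2}$ on $\mathcal{X}\times\mathcal{Y}$; $A^T:\mathcal{Y}\to\mathcal{X}$ is the adjoint of $A$. The Lagrangian is $\mathcal{L}(x,\lambda)=f(x)+\langle\lambda,Ax-b\rangle$. The primal-dual solution set $\Omega$ is the set of saddle points of $\mathcal{L}$, i.e. of pairs $(\hat x,\hat\lambda)\in\mathcal{X}\times\mathcal{Y}$ with $\mathcal{L}(\hat x,\lambda)\le\mathcal{L}(\hat x,\hat\lambda)\le\mathcal{L}(x,\hat\lambda)$ for all $(x,\lambda)$; equivalently $\nabla f(\hat x)+A^T\hat\lambda=0$ and $A\hat x=b$. For $t\ge t_0$, $\mathcal{L}_t(x,\lambda)=\mathcal{L}(x,\lambda)+\frac{c}{2t^p}(\|x\|^2-\|\lambda\|^2)$, and $(x_t,\lambda_t)$ denotes the unique saddle point of $\mathcal{L}_t$, i.e. $\mathcal{L}_t(x_t,\lambda)\le\mathcal{L}_t(x_t,\lambda_t)\le\mathcal{L}_t(x,\lambda_t)$ for all $(x,\lambda)\in\mathcal{X}\times\mathcal{Y}$. A solution of the system is a pair $x:[t_0,+\infty)\to\mathcal{X}$ twice differentiable, $\lambda:[t_0,+\infty)\to\mathcal{Y}$ differentiable, satisfying both equations for all $t\ge t_0$. The notation $g(t)\le\mathcal{O}(h(t))$ means that there are $C>0$ and $T\ge t_0$ with $g(t)\le C\,h(t)$ for all $t\ge T$. *)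

theory Defs
  imports "HOL-Analysis.Analysis"
begin

definition lagrangian ::
  "('a::real_inner \<Rightarrow> real) \<Rightarrow> ('a \<Rightarrow> 'b::real_inner) \<Rightarrow> 'b \<Rightarrow> 'a \<Rightarrow> 'b \<Rightarrow> real" where
  "lagrangian f A b x l = f x + l \<bullet> (A x - b)"

definition reg_lagrangian ::
  "('a::real_inner \<Rightarrow> real) \<Rightarrow> ('a \<Rightarrow> 'b::real_inner) \<Rightarrow> 'b \<Rightarrow> real \<Rightarrow> real \<Rightarrow> real
    \<Rightarrow> 'a \<Rightarrow> 'b \<Rightarrow> real" where
  "reg_lagrangian f A b c p t x l =
     lagrangian f A b x l + c / (2 * t powr p) * ((norm x)\<^sup>2 - (norm l)\<^sup>2)"

definition saddle_point :: "('a \<Rightarrow> 'b \<Rightarrow> real) \<Rightarrow> 'a \<times> 'b \<Rightarrow> bool" where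
  "saddle_point L z \<longleftrightarrow>
     (\<forall>x l. L (fst z) l \<le> L (fst z) (snd z) \<and> L (fst z) (snd z) \<le> L x (snd z))"

definition primal_dual_solutions ::
  "('a::real_inner \<Rightarrow> real) \<Rightarrow> ('a \<Rightarrow> 'b::real_inner) \<Rightarrow> 'b \<Rightarrow> ('a \<times> 'b) set" where
  "primal_dual_solutions f A b = {z. saddle_point (lagrangian f A b) z}"

text \<open>The argument \<open>gf\<close> is the gradient of the objective. Derivatives are taken within
  \<open>{t0..}\<close>, hence are one-sided at \<open>t0\<close>; values of \<open>x\<close> and \<open>l\<close> before \<open>t0\<close> are irrelevant.\<close>

definition is_solution ::
  "('a::real_inner \<Rightarrow> 'a) \<Rightarrow> ('a \<Rightarrow> 'b::real_inner) \<Rightarrow> 'b \<Rightarrow>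
    real \<Rightarrow> real \<Rightarrow> real \<Rightarrow> real \<Rightarrow> real \<Rightarrow> real \<Rightarrow> real \<Rightarrow>
    (real \<Rightarrow> 'a) \<Rightarrow> (real \<Rightarrow> 'b) \<Rightarrow> bool" where
  "is_solution gf A b t0 \<alpha> \<theta> q p c s x l \<longleftrightarrow>
     (\<exists>x' x'' l'. \<forall>t\<ge>t0.
        (x has_vector_derivative x' t) (at t within {t0..}) \<and>
        (x' has_vector_derivative x'' t) (at t within {t0..}) \<and>
        (l has_vector_derivative l' t) (at t within {t0..}) \<and>
        x'' t + (\<alpha> / t powr q) *\<^sub>R x' t
          + t powr s *\<^sub>R (gf (x t) + adjoint A (l t) + (c / t powr p) *\<^sub>R x t) = 0 \<and>
        l' t - t powr (q + s) *\<^sub>R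
          (A (x t + (\<theta> * t powr q) *\<^sub>R x' t) - b - (c / t powr p) *\<^sub>R l t) = 0)"

text \<open>The one-sided notation \<open>g t \<le> O (h t)\<close> as \<open>t\<close> tends to infinity: unlike the library's
  \<open>g \<in> O(h)\<close>, it bounds \<open>g\<close> rather than \<open>\<bar>g\<bar>\<close>.\<close>

definition le_bigo :: "real \<Rightarrow> (real \<Rightarrow> real) \<Rightarrow> (real \<Rightarrow> real) \<Rightarrow> bool" where
  "le_bigo t0 g h \<longleftrightarrow> (\<exists>C>0. \<exists>T\<ge>t0. \<forall>t\<ge>T. g t \<le> C * h t)"

end

theory Submission
  imports Defs
begin

text \<open>Along the flow, the energy \<open>E\<close> centred at the regularized saddle point \<open>z\<^sub>t\<close> (the primal-dual gap
  weighted by \<open>\<theta>\<^sup>2 t powr (2 q + s)\<close> plus squared distances) satisfies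
  \<open>E' + \<rho> t powr (- q) E \<le> C t powr (2 q + s - 1)\<close>. Hence \<open>E = O(t powr (3 q + s - 1))\<close> and the gap is
  \<open>O(t powr (q - 1))\<close>; strong convexity of the regularized Lagrangian turns the latter into the rate for
  \<open>x - x\<^sub>t\<close>. The path \<open>z\<^sub>t\<close> is only locally Lipschitz, and differentiating it almost everywhere would
  require the Radon-Nikodym property of Hilbert spaces. Instead, at each time \<open>t\<close> the energy is compared with
  its differentiable version frozen at \<open>z\<^sub>t\<close>, the error being controlled by
  \<open>norm (z\<^sub>t - z\<^sub>r) \<le> (t - r) / r * norm z\<close> for any primal-dual solution \<open>z\<close>, and a first-crossing
  argument replaces the integration of the differential inequality.\<close>

section \<open>Hilbert spaces and convex functions\<close>

text \<open>The representing vector is the minimizer of \<open>J\<close>. By the parallelogram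
  identity a minimizing sequence is Cauchy, since the value at each midpoint is still at least the
  infimum; completeness gives a limit, and the derivative of \<open>J\<close> vanishes
  there.\<close>

lemma riesz_representation:
  fixes \<phi> :: "'a::{real_inner,complete_space} \<Rightarrow> real"
  assumes "bounded_linear \<phi>"
  shows "\<exists>y. \<forall>x. \<phi> x = x \<bullet> y"
proof -
  interpret \<phi>: bounded_linear \<phi> by fact
  define J where "J x = 1 / 2 * (x \<bullet> x) - \<phi> x" for x :: 'a
  obtain K where K: "\<And>x. norm (\<phi> x) \<le> norm x * K"
    using \<phi>.bounded by blast
  have bdd: "bdd_below (range J)"
  proof (intro bdd_belowI2)
    fix x :: 'a
    have "0 \<le> (norm x - K)\<^sup>2" by simp
    moreover have "\<phi> x \<le> norm x * K" using K[of x] by simp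
    ultimately show "- (K\<^sup>2 / 2) \<le> J x"
      by (simp add: J_def power2_eq_square algebra_simps flip: power2_norm_eq_inner)
  qed
  define m where "m = Inf (range J)"
  have m_le: "m \<le> J x" for x
    unfolding m_def by (intro cInf_lower bdd) auto
  have "\<exists>x. J x < m + 1 / real (Suc n)" for n
  proof -
    have "Inf (range J) < m + 1 / real (Suc n)"
      unfolding m_def by simp
    then show ?thesis
      by (subst (asm) cInf_less_iff) (use bdd in auto)
  qed
  then obtain X where X: "\<And>n. J (X n) < m + 1 / real (Suc n)"
    by metis
  have parallelogram: "J a + J b - 2 * J ((1/2) *\<^sub>R (a + b)) = (norm (a - b))\<^sup>2 / 4" for a b
    by (simp add: J_def power2_norm_eq_inner \<phi>.add \<phi>.scaleR inner_add inner_diff inner_commute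
        algebra_simps)
  have dist_X: "(norm (X i - X j))\<^sup>2 \<le> 4 * (1 / real (Suc i) + 1 / real (Suc j))" for i j
    using parallelogram[of "X i" "X j"] X[of i] X[of j] m_le[of "(1/2) *\<^sub>R (X i + X j)"]
    by argo
  have "Cauchy X"
  proof (rule metric_CauchyI)
    fix e :: real
    assume "0 < e"
    then obtain N where N: "8 / e\<^sup>2 < real N"
      using reals_Archimedean2 by blast
    show "\<exists>M. \<forall>m\<ge>M. \<forall>n\<ge>M. dist (X m) (X n) < e"
    proof (intro exI allI impI)
      fix i j
      assume ij: "i \<ge> N" "j \<ge> N"
      have pos: "0 < real N" using N \<open>0 < e\<close> by (smt (verit) divide_nonneg_nonneg zero_le_power2)
      have "1 / real (Suc k) \<le> 1 / real N" if "k \<ge> N" for k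
        using that pos by (intro divide_left_mono) auto
      then have "4 * (1 / real (Suc i) + 1 / real (Suc j)) \<le> 4 * (1 / real N + 1 / real N)"
        using ij by (intro mult_left_mono add_mono) auto
      with dist_X[of i j] have "(norm (X i - X j))\<^sup>2 \<le> 8 / real N"
        by simp
      also have "\<dots> < e\<^sup>2"
        using N \<open>0 < e\<close> pos by (simp add: field_simps)
      finally show "dist (X i) (X j) < e"
        using \<open>0 < e\<close> by (simp add: dist_norm power_less_imp_less_base)
    qed
  qed
  then obtain y where y: "X \<longlonglongrightarrow> y"
    using Cauchy_convergent_iff convergent_def by blast
  have "(\<lambda>n. J (X n)) \<longlonglongrightarrow> J y"
    unfolding J_def by (intro tendsto_intros \<phi>.tendsto y)
  moreover have "(\<lambda>n. m + 1 / real (Suc n)) \<longlonglongrightarrow> m + 0"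
    by (intro tendsto_intros LIMSEQ_Suc lim_1_over_n)
  ultimately have "J y \<le> m + 0"
    by (rule LIMSEQ_le) (use X less_imp_le in blast)
  then have min: "J y \<le> J x" for x
    using m_le[of x] by simp
  have "(J has_derivative (\<lambda>h. 1 / 2 * (y \<bullet> h + h \<bullet> y) - \<phi> h)) (at y)"
    unfolding J_def by (auto intro!: derivative_eq_intros \<phi>.has_derivative)
  then have "(\<lambda>h. 1 / 2 * (y \<bullet> h + h \<bullet> y) - \<phi> h) = (\<lambda>h. 0)"
    by (rule has_derivative_local_min) (use min in auto)
  then have "\<phi> h = h \<bullet> y" for h
    by (simp add: fun_eq_iff inner_commute)
  then show ?thesis by blast
qed

text \<open>\<open>adjoint\<close> is defined by a choice operator, so its characteristic equation
  holds as soon as some adjoint map exists. Representing \<open>\<lambda>x. A x \<bullet> y\<close>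
  for each \<open>y\<close> supplies one.\<close>

lemma inner_adjoint_hilbert:
  fixes A :: "'a::{real_inner,complete_space} \<Rightarrow> 'b::real_inner"
  assumes "bounded_linear A"
  shows "x \<bullet> adjoint A y = A x \<bullet> y"
proof -
  have "\<forall>y. \<exists>z. \<forall>x. A x \<bullet> y = x \<bullet> z"
    by (intro allI riesz_representation bounded_linear_compose[OF bounded_linear_inner_left assms])
  then have "\<exists>f'. \<forall>x y. A x \<bullet> y = x \<bullet> f' y"
    by metis
  then have "\<forall>x y. A x \<bullet> y = x \<bullet> adjoint A y"
    unfolding adjoint_def by (rule someI_ex)
  then show ?thesis by simp
qed

text \<open>Restricting \<open>f\<close> to the line through \<open>y\<close> and \<open>z\<close>
  reduces the claim to the tangent inequality for a convex function of one real variable.\<close>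

lemma convex_gradient_ineq:
  fixes f :: "'a::real_inner \<Rightarrow> real"
  assumes "convex_on UNIV f" and "GDERIV f y :> g"
  shows "f y + g \<bullet> (z - y) \<le> f z"
proof -
  define h where "h r = f (y + r *\<^sub>R (z - y))" for r
  have "convex_on UNIV h"
  proof (rule convex_onI)
    fix u r1 r2 :: real
    assume u: "0 < u" "u < 1"
    have "y + ((1 - u) * r1 + u * r2) *\<^sub>R (z - y)
        = (1 - u) *\<^sub>R (y + r1 *\<^sub>R (z - y)) + u *\<^sub>R (y + r2 *\<^sub>R (z - y))"
      by (simp add: algebra_simps)
    then show "h ((1 - u) *\<^sub>R r1 + u *\<^sub>R r2) \<le> (1 - u) * h r1 + u * h r2"
      using convex_onD[OF assms(1), of u "y + r1 *\<^sub>R (z - y)" "y + r2 *\<^sub>R (z - y)"] u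
      by (simp add: h_def)
  qed simp
  moreover have "(h has_real_derivative g \<bullet> (z - y)) (at 0)"
  proof -
    have f': "(f has_derivative (\<lambda>v. v \<bullet> g)) (at (y + 0 *\<^sub>R (z - y)))"
      using assms(2) by (simp add: gderiv_def)
    have "((\<lambda>r. y + r *\<^sub>R (z - y)) has_derivative (\<lambda>r. r *\<^sub>R (z - y))) (at 0)"
      by (auto intro!: derivative_eq_intros)
    from has_derivative_compose[OF this f'] show ?thesis
      unfolding h_def has_field_derivative_def
      by (simp add: inner_commute mult.commute[of _ "inner _ _"] mult_commute_abs)
  qed
  ultimately have "h 1 - h 0 \<ge> (g \<bullet> (z - y)) * (1 - 0)"
    by (intro convex_on_imp_above_tangent[where A = UNIV]) auto
  then show ?thesis
    by (simp add: h_def)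
qed

text \<open>Fermat's rule in each variable: \<open>y\<close> minimizes \<open>P\<close> and
  \<open>\<nu>\<close> minimizes \<open>D\<close>. The parameter \<open>e\<close> covers both
  Lagrangians, with \<open>e = 0\<close> for the original one and \<open>e = c / t powr p\<close>
  for the regularized one.\<close>

lemma saddle_point_stationary:
  fixes f :: "'a::real_inner \<Rightarrow> real" and A :: "'a \<Rightarrow> 'b::real_inner"
  assumes saddle: "saddle_point (\<lambda>x l. lagrangian f A b x l + e / 2 * ((norm x)\<^sup>2 - (norm l)\<^sup>2)) (y, \<nu>)"
    and A: "bounded_linear A" and f': "GDERIV f y :> g"
  shows "g \<bullet> v + \<nu> \<bullet> A v + e * (y \<bullet> v) = 0" and "A y - b = e *\<^sub>R \<nu>"
proof -
  interpret A: bounded_linear A by fact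
  define P where "P x = f x + \<nu> \<bullet> (A x - b) + e / 2 * (x \<bullet> x - \<nu> \<bullet> \<nu>)" for x
  have "(P has_derivative (\<lambda>h. h \<bullet> g + \<nu> \<bullet> A h + e / 2 * (y \<bullet> h + h \<bullet> y))) (at y)"
    unfolding P_def using f' unfolding gderiv_def
    by (auto intro!: derivative_eq_intros A.has_derivative)
  moreover have "P y \<le> P x" for x
    using saddle by (auto simp: saddle_point_def lagrangian_def P_def power2_norm_eq_inner)
  ultimately have "(\<lambda>h. h \<bullet> g + \<nu> \<bullet> A h + e / 2 * (y \<bullet> h + h \<bullet> y)) = (\<lambda>h. 0)"
    by (intro has_derivative_local_min) auto
  from fun_cong[OF this, of v] show "g \<bullet> v + \<nu> \<bullet> A v + e * (y \<bullet> v) = 0"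
    by (simp add: inner_commute field_simps)
  define D where "D l = - (l \<bullet> (A y - b)) + e / 2 * (l \<bullet> l)" for l
  have "(D has_derivative (\<lambda>h. - (h \<bullet> (A y - b)) + e / 2 * (\<nu> \<bullet> h + h \<bullet> \<nu>))) (at \<nu>)"
    unfolding D_def by (auto intro!: derivative_eq_intros)
  moreover have "D \<nu> \<le> D l" for l
  proof -
    have "lagrangian f A b y l + e / 2 * ((norm y)\<^sup>2 - (norm l)\<^sup>2)
        \<le> lagrangian f A b y \<nu> + e / 2 * ((norm y)\<^sup>2 - (norm \<nu>)\<^sup>2)"
      using saddle by (simp add: saddle_point_def)
    then show ?thesis
      by (simp add: lagrangian_def D_def power2_norm_eq_inner algebra_simps)
  qed
  ultimately have "(\<lambda>h. - (h \<bullet> (A y - b)) + e / 2 * (\<nu> \<bullet> h + h \<bullet> \<nu>)) = (\<lambda>h. 0)"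
    by (intro has_derivative_local_min) auto
  then have "h \<bullet> (A y - b - e *\<^sub>R \<nu>) = 0" for h
    by (drule_tac x = h in fun_cong) (simp add: inner_diff inner_add_right inner_commute[of \<nu>] algebra_simps)
  \<comment> \<open>Testing with the residual itself shows that its squared norm is zero.\<close>
  from this[of "A y - b - e *\<^sub>R \<nu>"] show "A y - b = e *\<^sub>R \<nu>"
    by simp
qed

text \<open>Subtract the two stationarity conditions, tested with \<open>y1 - y2\<close>. The
  gradient contribution is nonnegative by convexity, and the two constraint equations turn the
  coupling through \<open>A\<close> into the dual half of the inner product. The parameters may
  differ: one of them zero bounds the saddle point path, two different times give its Lipschitz
  estimate.\<close>

lemma stationary_monotone:
  fixes A :: "'a::real_inner \<Rightarrow> 'b::real_inner"
  assumes f: "convex_on UNIV f" "\<And>y. GDERIV f y :> gf y" and A: "bounded_linear A"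
    and 1: "\<And>v. gf y1 \<bullet> v + \<nu>1 \<bullet> A v + e1 * (y1 \<bullet> v) = 0" "A y1 - b = e1 *\<^sub>R \<nu>1"
    and 2: "\<And>v. gf y2 \<bullet> v + \<nu>2 \<bullet> A v + e2 * (y2 \<bullet> v) = 0" "A y2 - b = e2 *\<^sub>R \<nu>2"
  shows "(e1 *\<^sub>R (y1, \<nu>1) - e2 *\<^sub>R (y2, \<nu>2)) \<bullet> ((y1, \<nu>1) - (y2, \<nu>2)) \<le> 0"
proof -
  interpret A: bounded_linear A by fact
  have Ay: "A (y1 - y2) = e1 *\<^sub>R \<nu>1 - e2 *\<^sub>R \<nu>2"
    using 1(2) 2(2) by (simp add: A.diff algebra_simps)
  have "f y1 + gf y1 \<bullet> (y2 - y1) \<le> f y2" "f y2 + gf y2 \<bullet> (y1 - y2) \<le> f y1"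
    by (rule convex_gradient_ineq; fact)+
  moreover have "gf y1 \<bullet> (y2 - y1) = - (gf y1 \<bullet> (y1 - y2))"
    by (simp add: inner_diff_right)
  ultimately have "0 \<le> gf y1 \<bullet> (y1 - y2) - gf y2 \<bullet> (y1 - y2)"
    by linarith
  moreover have "(e1 *\<^sub>R (y1, \<nu>1) - e2 *\<^sub>R (y2, \<nu>2)) \<bullet> ((y1, \<nu>1) - (y2, \<nu>2))
      = e1 * (y1 \<bullet> (y1 - y2)) - e2 * (y2 \<bullet> (y1 - y2)) + A (y1 - y2) \<bullet> (\<nu>1 - \<nu>2)"
    unfolding Ay by (simp add: inner_diff_left)
  moreover have "A (y1 - y2) \<bullet> (\<nu>1 - \<nu>2) = \<nu>1 \<bullet> A (y1 - y2) - \<nu>2 \<bullet> A (y1 - y2)"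
    by (simp add: inner_diff_left inner_commute[of "A (y1 - y2)"])
  ultimately show ?thesis
    using 1(1)[of "y1 - y2"] 2(1)[of "y1 - y2"] by linarith
qed

section \<open>Comparison of real functions\<close>

lemma powr_dominated:
  fixes a b C k :: real
  assumes "a < b" "0 < k"
  shows "eventually (\<lambda>t. C * t powr a \<le> k * t powr b) at_top"
proof -
  have "((\<lambda>t. C * t powr (a - b)) \<longlongrightarrow> C * 0) at_top"
    by (intro tendsto_intros tendsto_neg_powr filterlim_ident) (use assms in auto)
  then have "eventually (\<lambda>t. C * t powr (a - b) < k) at_top"
    by (rule order_tendstoD) (use assms in auto)
  with eventually_gt_at_top[of 0] show ?thesis
  proof eventually_elim
    case (elim t)
    then have "C * t powr (a - b) * t powr b \<le> k * t powr b"
      by (intro mult_right_mono) auto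
    then show ?case
      using elim by (simp add: mult.assoc flip: powr_add)
  qed
qed

text \<open>A form of the Gronwall comparison that needs no derivative of \<open>g\<close>: the hypothesis forbids
  a first crossing of zero from below.\<close>

lemma negative_if_no_upcrossing:
  fixes g :: "real \<Rightarrow> real"
  assumes cont: "continuous_on {T..} g" and neg: "g T < 0"
    and cross: "\<And>t. T < t \<Longrightarrow> g t = 0 \<Longrightarrow> \<exists>r\<in>{T..<t}. 0 \<le> g r"
    and "T \<le> t"
  shows "g t < 0"
proof (rule ccontr)
  assume "\<not> g t < 0"
  define S where "S = {r \<in> {T..}. g r \<in> {0..}}"
  have "closed S"
    using continuous_closed_preimage[OF cont closed_atLeast closed_atLeast[of 0]]
    by (simp add: S_def vimage_def Int_def)
  moreover have "t \<in> S" "bdd_below S"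
    using \<open>\<not> g t < 0\<close> \<open>T \<le> t\<close> by (auto simp: S_def)
  ultimately have Inf: "Inf S \<in> S" "\<And>r. r \<in> S \<Longrightarrow> Inf S \<le> r"
    \<comment> \<open>Since \<open>S\<close> is closed, its infimum is the first time at which
      \<open>g\<close> is nonnegative. The intermediate value theorem forces \<open>g\<close> to
      vanish there, and \<open>cross\<close> then produces an earlier element of
      \<open>S\<close>.\<close>
    using closed_contains_Inf[of S] cInf_lower[of _ S] by auto
  then have "T < Inf S"
    using neg by (cases "Inf S = T") (auto simp: S_def)
  moreover have "g (Inf S) = 0"
  proof (rule ccontr)
    assume "g (Inf S) \<noteq> 0"
    then have "0 < g (Inf S)"
      using Inf(1) by (auto simp: S_def)
    then obtain r where "T \<le> r" "r \<le> Inf S" "g r = 0"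
      using IVT'[of g T 0 "Inf S"] neg \<open>T < Inf S\<close> continuous_on_subset[OF cont]
      by (metis atLeastatMost_subset_iff atLeastAtMost_iff atLeast_iff less_eq_real_def subsetI)
    then show False
      using Inf(2)[of r] \<open>0 < g (Inf S)\<close> by (auto simp: S_def)
  qed
  ultimately obtain r where "T \<le> r" "r < Inf S" "0 \<le> g r"
    using cross[of "Inf S"] by auto
  then show False
    using Inf(2)[of r] by (simp add: S_def)
qed

section \<open>The frozen energy\<close>

lemma has_real_derivative_inner_self:
  fixes w :: "real \<Rightarrow> 'a::real_inner"
  assumes "(w has_vector_derivative w') (at t)"
  shows "((\<lambda>t. w t \<bullet> w t) has_real_derivative 2 * (w t \<bullet> w')) (at t)"
proof -
  have "((\<lambda>t. w t \<bullet> w t) has_derivative (\<lambda>h. w t \<bullet> (h *\<^sub>R w') + (h *\<^sub>R w') \<bullet> w t)) (at t)"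
    using assms unfolding has_vector_derivative_def by (intro has_derivative_inner)
  then show ?thesis
    unfolding has_field_derivative_def
    by (rule back_subst[where P = "\<lambda>D. (_ has_derivative D) _"])
      (auto simp: fun_eq_iff inner_commute)
qed

text \<open>The equation for the primal variable is stated weakly, tested against a vector \<open>w\<close>, so that
  the adjoint of \<open>A\<close> does not appear. The pair \<open>(xs, ls)\<close> is any primal-dual solution.\<close>

locale regularized_flow =
  fixes f :: "'a::real_inner \<Rightarrow> real" and gf :: "'a \<Rightarrow> 'a"
    and A :: "'a \<Rightarrow> 'b::real_inner" and b :: 'b
    and t0 \<alpha> \<theta> q p c s :: real
    and x x' x'' :: "real \<Rightarrow> 'a" and l l' :: "real \<Rightarrow> 'b"
    and xt :: "real \<Rightarrow> 'a" and lt :: "real \<Rightarrow> 'b" and xs :: 'a and ls :: 'b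
  assumes convex: "convex_on UNIV f"
    and grad: "\<And>y. GDERIV f y :> gf y"
    and bl_A: "bounded_linear A"
    and t0: "t0 > 0" and \<alpha>: "\<alpha> > 0" and \<theta>: "\<theta> > 1 / \<alpha>"
    and q: "0 \<le> q" "q < 1" and p: "0 < p" "p < 1 - q" and c: "c > 0"
    and s: "p - 2 * q < s"
    and x_deriv: "\<And>t. t > t0 \<Longrightarrow> (x has_vector_derivative x' t) (at t)"
    and x'_deriv: "\<And>t. t > t0 \<Longrightarrow> (x' has_vector_derivative x'' t) (at t)"
    and l_deriv: "\<And>t. t > t0 \<Longrightarrow> (l has_vector_derivative l' t) (at t)"
    and ode_x: "\<And>t w. t > t0 \<Longrightarrow> x'' t \<bullet> w + \<alpha> / t powr q * (x' t \<bullet> w)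
        + t powr s * (gf (x t) \<bullet> w + l t \<bullet> A w + c / t powr p * (x t \<bullet> w)) = 0"
    and ode_l: "\<And>t. t > t0 \<Longrightarrow> l' t = t powr (q + s) *\<^sub>R
          (A (x t + (\<theta> * t powr q) *\<^sub>R x' t) - b - (c / t powr p) *\<^sub>R l t)"
    and reg_x: "\<And>t v. t \<ge> t0 \<Longrightarrow> gf (xt t) \<bullet> v + lt t \<bullet> A v + c / t powr p * (xt t \<bullet> v) = 0"
    and reg_l: "\<And>t. t \<ge> t0 \<Longrightarrow> A (xt t) - b = (c / t powr p) *\<^sub>R lt t"
    and sol_x: "\<And>v. gf xs \<bullet> v + ls \<bullet> A v = 0"
    and sol_l: "A xs = b"
begin

sublocale A: bounded_linear A by (rule bl_A)

definition eps :: "real \<Rightarrow> real" where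
  "eps t = c / t powr p"

text \<open>This is \<open>reg_lagrangian f A b c p t (x t) \<nu> - reg_lagrangian f A b c p t y
  \<nu>\<close>; the vector \<open>b\<close> and the dual norms cancel.\<close>

definition gap :: "'a \<Rightarrow> 'b \<Rightarrow> real \<Rightarrow> real" where
  "gap y \<nu> t = f (x t) - f y + \<nu> \<bullet> A (x t - y) + eps t / 2 * (x t \<bullet> x t - y \<bullet> y)"

text \<open>With this weight on the squared distance of \<open>x t\<close> to \<open>y\<close>, the
  products of position and velocity cancel in the derivative of the energy, up to a term of relative
  size \<open>t powr (q - 1)\<close>.\<close>

definition \<kappa> :: real where
  "\<kappa> = \<alpha> * \<theta> - 1"

text \<open>The pair \<open>(y, \<nu>)\<close> is a constant argument, which keeps the function
  differentiable in \<open>t\<close>; the energy of the flow is its value at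
  \<open>(xt t, lt t)\<close>. The weight of the gap cancels the products of the gradient with the
  velocity, and the factor \<open>\<theta> / 2\<close> cancels the coupling of
  \<open>l t - \<nu>\<close> with \<open>A\<close>.\<close>

definition energy :: "'a \<Rightarrow> 'b \<Rightarrow> real \<Rightarrow> real" where
  "energy y \<nu> t = \<theta>\<^sup>2 * t powr (2 * q + s) * gap y \<nu> t
     + (x t - y + (\<theta> * t powr q) *\<^sub>R x' t) \<bullet> (x t - y + (\<theta> * t powr q) *\<^sub>R x' t) / 2
     + \<kappa> / 2 * ((x t - y) \<bullet> (x t - y)) + \<theta> / 2 * ((l t - \<nu>) \<bullet> (l t - \<nu>))"

definition energy_rate :: "'a \<Rightarrow> 'b \<Rightarrow> real \<Rightarrow> real" where
  "energy_rate y \<nu> t =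
      \<theta>\<^sup>2 * (2 * q + s) * (t powr q * t powr q * t powr s / t) * gap y \<nu> t
      - \<theta>\<^sup>2 * (t powr q * t powr q * t powr s) * (p * eps t / t / 2) * (x t \<bullet> x t - y \<bullet> y)
      + \<theta> * q * (t powr q / t) * ((x t - y) \<bullet> x' t)
      - \<theta> * t powr q * (\<kappa> - \<theta> * q * (t powr q / t)) * (x' t \<bullet> x' t)
      - \<theta> * (t powr q * t powr s)
          * (gf (x t) \<bullet> (x t - y) + \<nu> \<bullet> A (x t - y) + eps t * (x t \<bullet> (x t - y)))
      - \<theta> * (t powr q * t powr s) * eps t * ((l t - \<nu>) \<bullet> (l t - \<nu>))"

lemma \<theta>_pos: "\<theta> > 0" and \<kappa>_pos: "\<kappa> > 0"
  using \<theta> \<alpha> less_trans[of 0 "1 / \<alpha>" \<theta>] by (auto simp: \<kappa>_def field_simps)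

lemma eps_pos: "t > 0 \<Longrightarrow> eps t > 0"
  using c by (simp add: eps_def)

lemma eps_deriv:
  assumes "t > 0"
  shows "(eps has_real_derivative - (p * eps t / t)) (at t)"
proof -
  have "eps = (\<lambda>t. c * t powr (- p))"
    by (auto simp: eps_def powr_minus divide_inverse)
  moreover have "((\<lambda>t. c * t powr (- p)) has_real_derivative c * (- p * t powr (- p - 1))) (at t)"
    using assms by (auto intro!: derivative_eq_intros)
  moreover have "c * (- p * t powr (- p - 1)) = - (p * eps t / t)"
    using assms by (simp add: eps_def powr_minus powr_diff divide_inverse)
  ultimately show ?thesis by simp
qed

lemma gap_deriv:
  assumes "t > t0"
  shows "(gap y \<nu> has_real_derivative gf (x t) \<bullet> x' t + \<nu> \<bullet> A (x' t) + eps t * (x t \<bullet> x' t)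
    - p * eps t / t / 2 * (x t \<bullet> x t - y \<bullet> y)) (at t)"
proof -
  have "((\<lambda>t. f (x t)) has_derivative (\<lambda>h. (h *\<^sub>R x' t) \<bullet> gf (x t))) (at t)"
    using x_deriv[OF assms] grad[of "x t"] unfolding has_vector_derivative_def gderiv_def
    by (rule has_derivative_compose)
  then have f: "((\<lambda>t. f (x t)) has_real_derivative gf (x t) \<bullet> x' t) (at t)"
    unfolding has_field_derivative_def
    by (rule back_subst[where P = "\<lambda>D. (_ has_derivative D) _"])
      (auto simp: fun_eq_iff inner_commute)
  have "((\<lambda>t. \<nu> \<bullet> A (x t - y)) has_derivative (\<lambda>h. \<nu> \<bullet> A (h *\<^sub>R x' t))) (at t)"
    using x_deriv[OF assms] unfolding has_vector_derivative_def
    by (auto intro!: derivative_eq_intros A.has_derivative)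
  then have lin: "((\<lambda>t. \<nu> \<bullet> A (x t - y)) has_real_derivative \<nu> \<bullet> A (x' t)) (at t)"
    unfolding has_field_derivative_def
    by (rule back_subst[where P = "\<lambda>D. (_ has_derivative D) _"])
      (auto simp: fun_eq_iff A.scaleR)
  note sq = has_real_derivative_inner_self[OF x_deriv[OF assms]]
  have "t > 0" using t0 assms by simp
  then show ?thesis
    unfolding gap_def [abs_def]
    by (auto intro!: derivative_eq_intros f lin sq eps_deriv simp: field_simps)
qed

lemma energy_deriv:
  assumes t: "t > t0" and y: "A y - b = eps t *\<^sub>R \<nu>"
  shows "(energy y \<nu> has_real_derivative energy_rate y \<nu> t) (at t)"
proof -
  define Q where "Q = t powr q"
  define S where "S = t powr s"
  define v where "v = x t - y"
  define \<mu> where "\<mu> = l t - \<nu>"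
  have tpos: "t > 0" using t t0 by simp
  have Q: "Q > 0" and S: "S > 0" using tpos by (auto simp: Q_def S_def)
  define u where "u r = x r - y + (\<theta> * r powr q) *\<^sub>R x' r" for r
  define u' where "u' = (1 + \<theta> * q * (Q / t)) *\<^sub>R x' t + (\<theta> * Q) *\<^sub>R x'' t"
  have Qd: "((\<lambda>r. \<theta> * r powr q) has_real_derivative \<theta> * (q * (Q / t))) (at t)"
    using tpos by (auto intro!: derivative_eq_intros simp: Q_def powr_diff)
  have "((\<lambda>r. (\<theta> * r powr q) *\<^sub>R x' r) has_vector_derivative
      (\<theta> * t powr q) *\<^sub>R x'' t + (\<theta> * (q * (Q / t))) *\<^sub>R x' t) (at t)"
    by (rule has_vector_derivative_scaleR[OF Qd x'_deriv[OF t]])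
  then have ud: "(u has_vector_derivative u') (at t)"
    unfolding u_def [abs_def] u'_def using x_deriv[OF t]
    by (intro has_vector_derivative_eq_rhs[OF has_vector_derivative_add[OF
          has_vector_derivative_diff[OF _ has_vector_derivative_const]]])
      (assumption+, simp add: Q_def algebra_simps)
  have vd: "((\<lambda>r. x r - y) has_vector_derivative x' t) (at t)"
    using x_deriv[OF t] by (auto intro!: derivative_eq_intros)
  have md: "((\<lambda>r. l r - \<nu>) has_vector_derivative l' t) (at t)"
    using l_deriv[OF t] by (auto intro!: derivative_eq_intros)
  have QQ: "t powr (2 * q) = t powr q * t powr q" "t powr (q * 2) = t powr q * t powr q"
    using powr_add[of t q q] by (simp_all add: mult.commute)
  have Pd: "((\<lambda>r. r powr (2 * q + s)) has_real_derivative (2 * q + s) * (Q * Q * S / t)) (at t)"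
    using tpos by (auto intro!: derivative_eq_intros simp: QQ Q_def S_def powr_diff powr_add field_simps)
  have P: "t powr (2 * q + s) = Q * Q * S"
    by (simp add: Q_def S_def powr_add QQ(1))
  note sq = has_real_derivative_inner_self[OF ud] has_real_derivative_inner_self[OF vd]
    has_real_derivative_inner_self[OF md]
  have E: "energy y \<nu> = (\<lambda>r. \<theta>\<^sup>2 * r powr (2 * q + s) * gap y \<nu> r + 1 / 2 * (u r \<bullet> u r)
      + \<kappa> / 2 * ((x r - y) \<bullet> (x r - y)) + \<theta> / 2 * ((l r - \<nu>) \<bullet> (l r - \<nu>)))"
    by (auto simp: energy_def u_def)
  define G where "G = gf (x t) \<bullet> x' t + \<nu> \<bullet> A (x' t) + eps t * (x t \<bullet> x' t)
    - p * eps t / t / 2 * (x t \<bullet> x t - y \<bullet> y)"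
  have deriv: "(energy y \<nu> has_real_derivative
      \<theta>\<^sup>2 * ((2 * q + s) * (Q * Q * S / t) * gap y \<nu> t + Q * Q * S * G)
      + u t \<bullet> u' + \<kappa> * (v \<bullet> x' t) + \<theta> * (\<mu> \<bullet> l' t)) (at t)"
    unfolding E
    by (rule DERIV_cong[OF DERIV_add[OF DERIV_add[OF DERIV_add[OF
          DERIV_mult[OF DERIV_cmult[OF Pd] gap_deriv[OF t]]
          DERIV_cmult[OF sq(1)]] DERIV_cmult[OF sq(2)]] DERIV_cmult[OF sq(3)]]])
      (unfold P G_def v_def \<mu>_def, simp add: algebra_simps)
  have Au: "A (u t) = A v + (\<theta> * Q) *\<^sub>R A (x' t)"
    by (simp add: u_def v_def Q_def A.add A.scaleR)
  have ut: "u t = v + (\<theta> * Q) *\<^sub>R x' t"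
    by (simp add: u_def v_def Q_def)
  have uu': "u t \<bullet> u' = (1 + \<theta> * q * (Q / t)) * (u t \<bullet> x' t) + \<theta> * Q * (x'' t \<bullet> u t)"
    by (simp add: u'_def inner_add_right inner_commute)
  \<comment> \<open>The acceleration is eliminated by testing the primal equation with
    \<open>u t\<close> itself.\<close>
  have x''u: "x'' t \<bullet> u t = - (\<alpha> / Q) * (x' t \<bullet> u t)
      - S * (gf (x t) \<bullet> u t + l t \<bullet> A (u t) + eps t * (x t \<bullet> u t))"
    using ode_x[OF t, of "u t"] by (simp add: Q_def S_def eps_def algebra_simps)
  have "A (x t) - b = A v + eps t *\<^sub>R \<nu>"
    using y by (simp add: v_def A.diff algebra_simps)
  then have l': "l' t = (Q * S) *\<^sub>R (A v + (\<theta> * Q) *\<^sub>R A (x' t) - eps t *\<^sub>R \<mu>)"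
    unfolding ode_l[OF t]
    by (simp add: Q_def S_def powr_add A.add A.scaleR eps_def \<mu>_def algebra_simps)
  have ml: "\<mu> \<bullet> l' t = Q * S * (\<mu> \<bullet> A v + \<theta> * Q * (\<mu> \<bullet> A (x' t)) - eps t * (\<mu> \<bullet> \<mu>))"
    unfolding l' by (simp add: inner_add_right inner_diff_right algebra_simps)
  have lt: "l t = \<nu> + \<mu>" by (simp add: \<mu>_def)
  have "u t \<bullet> u' = (1 + \<theta> * q * (Q / t) - \<alpha> * \<theta>) * (v \<bullet> x' t + \<theta> * Q * (x' t \<bullet> x' t))
     - \<theta> * Q * S * (gf (x t) \<bullet> v + \<theta> * Q * (gf (x t) \<bullet> x' t)
         + \<nu> \<bullet> A v + \<mu> \<bullet> A v + \<theta> * Q * (\<nu> \<bullet> A (x' t) + \<mu> \<bullet> A (x' t))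
         + eps t * (x t \<bullet> v + \<theta> * Q * (x t \<bullet> x' t)))"
    unfolding uu' x''u unfolding Au unfolding ut lt using Q
    by (simp add: inner_add_left inner_add_right inner_commute[of "x' t" v] field_simps)
  then show ?thesis
    unfolding energy_rate_def
    by (intro DERIV_cong[OF deriv], fold Q_def S_def v_def \<mu>_def)
      (simp add: ml G_def \<kappa>_def power2_eq_square algebra_simps add_divide_distrib)
qed

end

lemma inner_self_add_ge:
  fixes a w :: "'a::real_inner"
  assumes "norm w \<le> d"
  shows "a \<bullet> a - 2 * (norm a * d) \<le> (a + w) \<bullet> (a + w)"
proof -
  have "- (a \<bullet> w) \<le> norm a * d"
    using Cauchy_Schwarz_ineq2[of a w] mult_left_mono[OF assms norm_ge_zero[of a]] by linarith
  moreover have "0 \<le> w \<bullet> w" by simp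
  moreover have "(a + w) \<bullet> (a + w) = a \<bullet> a + 2 * (a \<bullet> w) + w \<bullet> w"
    by (simp add: inner_add_left inner_add_right inner_commute)
  ultimately show ?thesis by linarith
qed

lemma young_linear:
  fixes a k V :: real
  assumes "k > 0"
  shows "a * V \<le> k * V\<^sup>2 + a\<^sup>2 / (4 * k)"
proof -
  have "0 \<le> (2 * k * V - a)\<^sup>2 / (4 * k)" using assms by simp
  also have "\<dots> = k * V\<^sup>2 + a\<^sup>2 / (4 * k) - a * V"
    using assms by (simp add: power2_eq_square field_simps)
  finally show ?thesis by simp
qed

context regularized_flow
begin

text \<open>The norm of one primal-dual solution serves both as a bound for the path
  \<open>(xt t, lt t)\<close> and as the constant in its Lipschitz estimate.\<close>

definition Z :: real where
  "Z = norm (xs, ls)"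

text \<open>Bounds the effect on \<open>energy\<close> of moving the frozen pair \<open>(y, \<nu>)\<close>, per unit of distance.\<close>

definition drift :: "'a \<Rightarrow> 'b \<Rightarrow> real \<Rightarrow> real" where
  "drift y \<nu> t = norm (x t - y + (\<theta> * t powr q) *\<^sub>R x' t) + \<kappa> * norm (x t - y)
     + \<theta> * norm (l t - \<nu>) + \<theta>\<^sup>2 * t powr (2 * q + s) * (onorm A * norm (x t - y))"

text \<open>The gradient inequality for \<open>f\<close> is added to the exact expansion of the
  quadratic term at \<open>xt t\<close>; the linear terms vanish by stationarity, so strong
  convexity with modulus \<open>eps t\<close> remains.\<close>

lemma reg_minimal:
  assumes "t \<ge> t0"
  shows "f (xt t) + lt t \<bullet> A (xt t) + eps t / 2 * (xt t \<bullet> xt t)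
      + eps t / 2 * ((y - xt t) \<bullet> (y - xt t))
    \<le> f y + lt t \<bullet> A y + eps t / 2 * (y \<bullet> y)"
  using convex_gradient_ineq[OF convex grad, of "xt t" y] reg_x[OF assms, of "y - xt t"]
  by (simp add: A.diff inner_diff_left inner_diff_right inner_commute algebra_simps flip: eps_def)

lemma gap_ge:
  assumes "t \<ge> t0"
  shows "eps t / 2 * (norm (x t - xt t))\<^sup>2 \<le> gap (xt t) (lt t) t"
  using reg_minimal[OF assms, of "x t"]
  by (simp add: gap_def power2_norm_eq_inner A.diff inner_diff_right[of "lt t"] right_diff_distrib)

text \<open>Convexity of \<open>f\<close> at \<open>x t\<close> together with the exact expansion of
  the square. It makes the gradient term of \<open>energy_rate\<close> dissipate both the gap and
  the squared distance to \<open>y\<close>.\<close>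

lemma gap_le_grad:
  assumes "t > 0"
  shows "gap y \<nu> t + eps t / 2 * (norm (x t - y))\<^sup>2
    \<le> gf (x t) \<bullet> (x t - y) + \<nu> \<bullet> A (x t - y) + eps t * (x t \<bullet> (x t - y))"
proof -
  have "f (x t) + gf (x t) \<bullet> (y - x t) \<le> f y"
    by (rule convex_gradient_ineq[OF convex grad])
  moreover have "gf (x t) \<bullet> (y - x t) = - (gf (x t) \<bullet> (x t - y))"
    by (simp add: inner_diff_right)
  moreover have "eps t / 2 * (x t \<bullet> x t - y \<bullet> y) + eps t / 2 * (norm (x t - y))\<^sup>2
      = eps t * (x t \<bullet> (x t - y))"
    by (simp add: power2_norm_eq_inner inner_diff_left inner_diff_right inner_commute field_simps)
  ultimately show ?thesis
    by (simp add: gap_def)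
qed

text \<open>Monotonicity between the regularized saddle point and the solution
  \<open>(xs, ls)\<close>, whose parameter is zero, followed by the Cauchy-Schwarz
  inequality.\<close>

lemma norm_reg_le:
  assumes "t \<ge> t0"
  shows "norm (xt t, lt t) \<le> Z"
proof -
  have "t > 0" using assms t0 by simp
  have "(eps t *\<^sub>R (xt t, lt t) - 0 *\<^sub>R (xs, ls)) \<bullet> ((xt t, lt t) - (xs, ls)) \<le> 0"
    using sol_x sol_l reg_x[OF assms] reg_l[OF assms]
    by (intro stationary_monotone[OF convex grad bl_A, of _ _ _ b]) (auto simp: eps_def)
  then have "eps t * ((xt t, lt t) \<bullet> ((xt t, lt t) - (xs, ls))) \<le> 0"
    by (simp only: scaleR_zero_left diff_zero inner_scaleR_left)
  then have "(xt t, lt t) \<bullet> ((xt t, lt t) - (xs, ls)) \<le> 0"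
    using eps_pos[OF \<open>t > 0\<close>] by (simp only: mult_le_0_iff) linarith
  then have "(norm (xt t, lt t))\<^sup>2 \<le> (xt t, lt t) \<bullet> (xs, ls)"
    by (simp only: power2_norm_eq_inner inner_diff_right)
  also have "\<dots> \<le> norm (xt t, lt t) * Z"
    unfolding Z_def by (rule norm_cauchy_schwarz)
  finally show ?thesis
    by (smt (verit) mult_le_cancel_left norm_ge_zero power2_eq_square Z_def)
qed

lemma norm_xt_le: "t \<ge> t0 \<Longrightarrow> norm (xt t) \<le> Z"
  and norm_lt_le: "t \<ge> t0 \<Longrightarrow> norm (lt t) \<le> Z"
  using norm_reg_le[of t] norm_fst_le[of "xt t" "lt t"] norm_snd_le[of "lt t" "xt t"] by linarith+

text \<open>Monotonicity between two times bounds \<open>eps t\<close> times the squared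
  displacement by \<open>eps r - eps t\<close> times the displacement and \<open>Z\<close>. The
  claim follows because \<open>eps\<close> decreases slowly.\<close>

lemma reg_lipschitz:
  assumes "t0 \<le> r" "r \<le> t"
  shows "norm ((xt t, lt t) - (xt r, lt r)) \<le> (t - r) / r * Z"
proof -
  define a where "a = (xt t, lt t)"
  define b' where "b' = (xt r, lt r)"
  have r: "r > 0" "t > 0" using assms t0 by auto
  have "(eps t *\<^sub>R a - eps r *\<^sub>R b') \<bullet> (a - b') \<le> 0"
    using reg_x reg_l assms unfolding a_def b'_def
    by (intro stationary_monotone[OF convex grad bl_A, of _ _ _ b]) (auto simp: eps_def)
  moreover have "eps t *\<^sub>R a - eps r *\<^sub>R b' = eps t *\<^sub>R (a - b') - (eps r - eps t) *\<^sub>R b'"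
    by (simp add: algebra_simps)
  ultimately have "eps t * (norm (a - b'))\<^sup>2 \<le> (eps r - eps t) * (b' \<bullet> (a - b'))"
    by (simp add: inner_diff_left[of "eps t *\<^sub>R (a - b')"] power2_norm_eq_inner)
  also have "b' \<bullet> (a - b') \<le> Z * norm (a - b')"
    using norm_cauchy_schwarz[of b' "a - b'"] norm_reg_le[OF assms(1)]
      mult_right_mono[of "norm b'" Z "norm (a - b')"] by (simp add: b'_def)
  also have "(eps r - eps t) * (Z * norm (a - b')) \<le> eps t * ((t - r) / r) * (Z * norm (a - b'))"
  proof (rule mult_right_mono)
    \<comment> \<open>Here \<open>p < 1\<close>, a consequence of \<open>p < 1 - q\<close> and
      \<open>0 \<le> q\<close>, replaces the power by a bound linear in
      \<open>t - r\<close>.\<close>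
    have "(t / r) powr p \<le> (t / r) powr 1"
      using assms r p q by (intro powr_mono) auto
    then have "eps r \<le> eps t * (t / r)"
      using r c by (simp add: eps_def powr_divide field_simps)
    then show "eps r - eps t \<le> eps t * ((t - r) / r)"
      using r by (simp add: field_simps)
    show "0 \<le> Z * norm (a - b')" by (simp add: Z_def)
  qed
  finally have *: "eps t * (norm (a - b'))\<^sup>2 \<le> eps t * ((t - r) / r) * (Z * norm (a - b'))"
    using c assms r p by (simp add: eps_def mult_left_mono divide_left_mono powr_mono2)
  have "norm (a - b') \<le> (t - r) / r * Z"
  proof (cases "a = b'")
    case True
    then show ?thesis using assms r by (simp add: Z_def)
  next
    case False
    then have "0 < eps t * norm (a - b')" using eps_pos[OF r(2)] by simp
    moreover have "(eps t * norm (a - b')) * norm (a - b')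
        \<le> (eps t * norm (a - b')) * ((t - r) / r * Z)"
      using * by (simp add: power2_eq_square mult.assoc mult.left_commute mult.commute)
    ultimately show ?thesis by (simp only: mult_le_cancel_left_pos)
  qed
  then show ?thesis by (simp add: a_def b'_def)
qed

lemma energy_unfreeze:
  assumes "t0 \<le> r" "t0 \<le> t"
  shows "energy (xt t) (lt t) r - norm ((xt t, lt t) - (xt r, lt r)) * drift (xt t) (lt t) r
    \<le> energy (xt r) (lt r) r"
proof -
  define d where "d = norm ((xt t, lt t) - (xt r, lt r))"
  define w where "w = xt t - xt r"
  define n where "n = lt t - lt r"
  define u where "u = x r - xt t + (\<theta> * r powr q) *\<^sub>R x' r"
  have w: "norm w \<le> d" and n: "norm n \<le> d"
    using norm_fst_le[of w n] norm_snd_le[of n w] by (auto simp: d_def w_def n_def)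
  have shift: "x r - xt r + (\<theta> * r powr q) *\<^sub>R x' r = u + w" "x r - xt r = x r - xt t + w"
    "l r - lt r = l r - lt t + n"
    by (auto simp: u_def w_def n_def)
  have "u \<bullet> u - 2 * (norm u * d) \<le> (u + w) \<bullet> (u + w)"
    by (rule inner_self_add_ge[OF w])
  moreover have "\<kappa> / 2 * ((x r - xt t) \<bullet> (x r - xt t) - 2 * (norm (x r - xt t) * d))
      \<le> \<kappa> / 2 * ((x r - xt r) \<bullet> (x r - xt r))"
    using \<kappa>_pos inner_self_add_ge[OF w, of "x r - xt t"]
    by (intro mult_left_mono) (auto simp: shift)
  moreover have "\<theta> / 2 * ((l r - lt t) \<bullet> (l r - lt t) - 2 * (norm (l r - lt t) * d))
      \<le> \<theta> / 2 * ((l r - lt r) \<bullet> (l r - lt r))"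
    using \<theta>_pos inner_self_add_ge[OF n, of "l r - lt t"]
    by (intro mult_left_mono) (auto simp: shift)
  moreover have "\<theta>\<^sup>2 * r powr (2 * q + s) * (gap (xt t) (lt t) r - d * (onorm A * norm (x r - xt t)))
      \<le> \<theta>\<^sup>2 * r powr (2 * q + s) * gap (xt r) (lt r) r"
  proof (rule mult_left_mono)
    have "0 \<le> eps r / 2 * ((xt t - xt r) \<bullet> (xt t - xt r))"
      using eps_pos[of r] assms t0 by simp
    then have "f (xt r) + lt r \<bullet> A (xt r) + eps r / 2 * (xt r \<bullet> xt r)
        \<le> f (xt t) + lt r \<bullet> A (xt t) + eps r / 2 * (xt t \<bullet> xt t)"
      using reg_minimal[OF assms(1), of "xt t"] by linarith
    \<comment> \<open>Changing the primal centre costs nothing because \<open>xt r\<close> is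
      minimal for the multiplier \<open>lt r\<close>; only the change of the multiplier has to be
      paid for.\<close>
    then have "gap (xt t) (lt r) r \<le> gap (xt r) (lt r) r"
      by (simp add: gap_def A.diff inner_diff_right right_diff_distrib)
    moreover have "gap (xt t) (lt t) r - gap (xt t) (lt r) r = n \<bullet> A (x r - xt t)"
      by (simp add: gap_def n_def inner_diff_left)
    moreover have "n \<bullet> A (x r - xt t) \<le> norm n * norm (A (x r - xt t))"
      by (rule norm_cauchy_schwarz)
    moreover have "\<dots> \<le> d * (onorm A * norm (x r - xt t))"
      using n onorm[OF bl_A, of "x r - xt t"] by (intro mult_mono) (auto simp: d_def)
    ultimately show "gap (xt t) (lt t) r - d * (onorm A * norm (x r - xt t)) \<le> gap (xt r) (lt r) r"
      by linarith
  qed simp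
  ultimately show ?thesis
    unfolding energy_def drift_def d_def[symmetric] u_def[symmetric] shift(1)
    by (simp only: ring_distribs right_diff_distrib times_divide_eq_left) (simp add: mult.commute mult.left_commute)
qed


subsection \<open>Dissipation and convergence rates\<close>

text \<open>A decay rate small enough that \<open>\<rho> / t powr q * energy\<close> spends at most
  a quarter of the gap dissipation and a quarter of the velocity dissipation.\<close>

definition \<rho> :: real where
  "\<rho> = min 1 \<kappa> / (4 * \<theta>)"

lemma \<rho>: "\<rho> > 0" "\<rho> * \<theta> \<le> 1 / 4" "\<rho> * \<theta> \<le> \<kappa> / 4"
  using \<theta>_pos \<kappa>_pos by (auto simp: \<rho>_def min_def field_simps)

text \<open>Every term of \<open>energy_rate\<close> and \<open>drift\<close> that has no sign is absorbed, by Young's inequality,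
  into the four dissipative terms; each of the five remainders is of lower order than
  \<open>t powr (2 * q + s - 1)\<close>.\<close>

lemma dissipation:
  "eventually (\<lambda>t. energy_rate (xt t) (lt t) t + Z / t * drift (xt t) (lt t) t
      \<le> 5 * t powr (2 * q + s - 1) - \<rho> / t powr q * energy (xt t) (lt t) t) at_top"
proof -
  define K where "K = onorm A"
  have K: "K \<ge> 0" unfolding K_def by (rule onorm_pos_le[OF bl_A])
  have Z0: "Z \<ge> 0" by (simp add: Z_def)
  note \<theta>p = \<theta>_pos and \<kappa>p = \<kappa>_pos
  \<comment> \<open>The first five comparisons place lower-order coefficients below fractions of the
    dissipation; the last five bound the Young remainders and the term from the decay of
    \<open>eps\<close>. The second and third rest on \<open>p - 2 * q < s\<close>, the seventh on
    \<open>p + q < 1\<close>.\<close>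
  have "eventually (\<lambda>t. \<theta> * \<bar>2 * q + s\<bar> * t powr (q - 1) \<le> 1 / 4 * t powr 0) at_top"
    "eventually (\<lambda>t. (1 + \<kappa> / 2) * \<rho> * t powr (- q) \<le> \<theta> * c / 8 * t powr (q + s - p)) at_top"
    "eventually (\<lambda>t. \<theta> * \<rho> / 2 * t powr (- q) \<le> \<theta> * c / 4 * t powr (q + s - p)) at_top"
    "eventually (\<lambda>t. \<theta> * q * t powr (q - 1) \<le> \<kappa> / 4 * t powr 0) at_top"
    "eventually (\<lambda>t. \<theta> * q\<^sup>2 / \<kappa> * t powr (q - 2) \<le> \<theta> * c / 8 * t powr (q + s - p)) at_top"
    "eventually (\<lambda>t. 2 * (Z * (1 + \<kappa>))\<^sup>2 / (\<theta> * c) * t powr (p - q - s - 2)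
        \<le> 1 * t powr (2 * q + s - 1)) at_top"
    "eventually (\<lambda>t. 2 * (Z * \<theta>\<^sup>2 * K)\<^sup>2 / (\<theta> * c) * t powr (p + q + q + q + s - 2)
        \<le> 1 * t powr (2 * q + s - 1)) at_top"
    "eventually (\<lambda>t. (Z * \<theta>)\<^sup>2 / (\<theta> * c) * t powr (p - q - s - 2)
        \<le> 1 * t powr (2 * q + s - 1)) at_top"
    "eventually (\<lambda>t. (Z * \<theta>)\<^sup>2 / (\<theta> * \<kappa>) * t powr (q - 2) \<le> 1 * t powr (2 * q + s - 1)) at_top"
    "eventually (\<lambda>t. \<theta>\<^sup>2 * p * c * Z\<^sup>2 / 2 * t powr (q + q + s - p - 1)
        \<le> 1 * t powr (2 * q + s - 1)) at_top"
    using \<theta>p \<kappa>p c q p s by (intro powr_dominated; simp)+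
  with eventually_gt_at_top[of t0] show ?thesis
  proof eventually_elim
    case (elim t)
    define Q where "Q = t powr q"
    define S where "S = t powr s"
    define P where "P = t powr p"
    define G where "G = t powr (2 * q + s - 1)"
    define e where "e = eps t"
    have t: "t > t0" "t > 0" using elim t0 by auto
    have pos: "Q > 0" "S > 0" "P > 0" "e > 0" "t > 0"
      using t eps_pos by (auto simp: Q_def S_def P_def e_def)
    have e: "e = c / P" by (simp add: e_def eps_def P_def)
    have pw: "t powr (q - 1) = Q / t" "t powr (- q) = 1 / Q" "t powr (q + s - p) = Q * S / P"
      "t powr (q - 2) = Q / (t * t)" "t powr (p - q - s - 2) = P / (Q * S * (t * t))"
      "t powr (p + q + q + q + s - 2) = P * Q * Q * Q * S / (t * t)"
      "t powr (q + q + s - p - 1) = Q * Q * S / (P * t)" "t powr 0 = 1"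
      using t unfolding Q_def S_def P_def powr_diff powr_add powr_minus_divide
      by (simp_all add: power2_eq_square)
    have pw2: "t powr (2 * q + s) = Q * Q * S"
      unfolding mult_2 Q_def S_def powr_add ..
    \<comment> \<open>The first entry of \<open>ev\<close> is \<open>t > t0\<close>, so the ten
      comparisons are \<open>ev(2)\<close> to \<open>ev(11)\<close>.\<close>
    note ev = elim[folded G_def, unfolded pw mult_1 mult_1_right]
    define y where "y = xt t"
    define \<nu> where "\<nu> = lt t"
    define \<phi> where "\<phi> = gap y \<nu> t"
    define V where "V = norm (x t - y)"
    define X where "X = norm (x' t)"
    define U where "U = norm (l t - \<nu>)"
    define H where "H = \<theta> * (Q * S) * e"
    have nn: "V \<ge> 0" "X \<ge> 0" "U \<ge> 0" by (auto simp: V_def X_def U_def)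
    have H: "H > 0" using pos \<theta>p by (simp add: H_def)
    have \<phi>: "\<phi> \<ge> 0"
      using gap_ge[of t] t pos(4) unfolding \<phi>_def y_def \<nu>_def e_def
      by (smt (verit) divide_nonneg_nonneg mult_nonneg_nonneg zero_le_power2)
    have norm_y: "y \<bullet> y \<le> Z\<^sup>2"
      using norm_xt_le[of t] t unfolding y_def power2_norm_eq_inner[symmetric]
      by (intro power_mono) auto
    define u where "u = x t - y + (\<theta> * Q) *\<^sub>R x' t"
    have norm_u: "norm u \<le> V + \<theta> * Q * X"
      using norm_triangle_ineq[of "x t - y" "(\<theta> * Q) *\<^sub>R x' t"] \<theta>p pos
      by (simp add: u_def V_def X_def)
    have uu: "u \<bullet> u \<le> 2 * V\<^sup>2 + 2 * (\<theta> * Q * X)\<^sup>2"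
    proof -
      have "u \<bullet> u \<le> (V + \<theta> * Q * X)\<^sup>2"
        unfolding power2_norm_eq_inner[symmetric] using norm_u by (intro power_mono) auto
      also have "\<dots> \<le> 2 * V\<^sup>2 + 2 * (\<theta> * Q * X)\<^sup>2"
        using zero_le_power2[of "V - \<theta> * Q * X"] by (simp add: power2_sum power2_diff)
      finally show ?thesis .
    qed
    \<comment> \<open>\<open>T1\<close> to \<open>T6\<close> treat the terms of
      \<open>energy_rate\<close> in order, \<open>L1\<close> to \<open>L4\<close> the parts of the
      drift, and \<open>E\<close> the energy. The budget is: the whole gap term, of which
      \<open>T1\<close> and \<open>E\<close> take a quarter each; \<open>H * V\<^sup>2 / 2\<close>,
      spent in eighths by \<open>T3\<close>, \<open>L1\<close>, \<open>L2\<close>, \<open>E\<close>;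
      three quarters of the velocity term left by \<open>T4\<close>, spent in quarters by
      \<open>T3\<close>, \<open>L4\<close>, \<open>E\<close>; and \<open>H * U\<^sup>2\<close>, of
      which \<open>L3\<close> and \<open>E\<close> take a quarter each. The five copies of
      \<open>G\<close> come from \<open>T2\<close> and \<open>L1\<close> to
      \<open>L4\<close>.\<close>
    have T1: "\<theta>\<^sup>2 * (2 * q + s) * (Q * Q * S / t) * \<phi> \<le> 1 / 4 * (\<theta> * (Q * S) * \<phi>)"
    proof -
      have "\<theta> * (2 * q + s) * (Q / t) \<le> \<theta> * \<bar>2 * q + s\<bar> * (Q / t)"
        using \<theta>p pos by (intro mult_right_mono mult_left_mono) auto
      also have "\<dots> \<le> 1 / 4" using ev(2) by simp
      finally have "\<theta> * (2 * q + s) * (Q / t) * (\<theta> * (Q * S) * \<phi>) \<le> 1 / 4 * (\<theta> * (Q * S) * \<phi>)"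
        using \<theta>p pos \<phi> by (intro mult_right_mono) auto
      then show ?thesis by (simp add: power2_eq_square mult_ac)
    qed
    have T2: "- (\<theta>\<^sup>2 * (Q * Q * S) * (p * e / t / 2) * (x t \<bullet> x t - y \<bullet> y)) \<le> G"
    proof -
      have "- (x t \<bullet> x t - y \<bullet> y) \<le> Z\<^sup>2" using norm_y inner_ge_zero[of "x t"] by linarith
      then have "\<theta>\<^sup>2 * (Q * Q * S) * (p * e / t / 2) * (- (x t \<bullet> x t - y \<bullet> y))
          \<le> \<theta>\<^sup>2 * (Q * Q * S) * (p * e / t / 2) * Z\<^sup>2"
        using pos p by (intro mult_left_mono) auto
      also have "\<dots> = \<theta>\<^sup>2 * p * c * Z\<^sup>2 / 2 * (Q * Q * S / (P * t))"
        by (simp add: e mult_ac)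
      also have "\<dots> \<le> G" using ev(11) by simp
      finally show ?thesis by (simp only: mult_minus_right)
    qed
    have T3: "\<theta> * q * (Q / t) * ((x t - y) \<bullet> x' t) \<le> 1 / 4 * (\<theta> * \<kappa> * Q * X\<^sup>2) + 1 / 8 * (H * V\<^sup>2)"
    proof -
      have "\<theta> * q * (Q / t) * ((x t - y) \<bullet> x' t) \<le> \<theta> * q * (Q / t) * (V * X)"
        using \<theta>p q pos norm_cauchy_schwarz[of "x t - y" "x' t"]
        by (intro mult_left_mono) (auto simp: V_def X_def)
      also have "\<dots> = (\<theta> * q * (Q / t) * V) * X" by simp
      also have "\<dots> \<le> (\<theta> * \<kappa> * Q / 4) * X\<^sup>2 + (\<theta> * q * (Q / t) * V)\<^sup>2 / (4 * (\<theta> * \<kappa> * Q / 4))"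
        by (rule young_linear) (use \<theta>p \<kappa>p pos in auto)
      also have "(\<theta> * q * (Q / t) * V)\<^sup>2 / (4 * (\<theta> * \<kappa> * Q / 4)) = \<theta> * q\<^sup>2 / \<kappa> * (Q / (t * t)) * V\<^sup>2"
        using \<theta>p \<kappa>p pos by (simp add: power2_eq_square mult_ac)
      also have "\<dots> \<le> \<theta> * c / 8 * (Q * S / P) * V\<^sup>2"
        using ev(6) by (intro mult_right_mono) auto
      also have "\<dots> = 1 / 8 * (H * V\<^sup>2)"
        by (simp add: H_def e)
      finally show ?thesis by simp
    qed
    have T4: "- (\<theta> * Q * (\<kappa> - \<theta> * q * (Q / t)) * (x' t \<bullet> x' t)) \<le> - (3 / 4 * (\<theta> * \<kappa> * Q * X\<^sup>2))"
    proof -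
      have "\<theta> * q * (Q / t) \<le> \<kappa> / 4" using ev(5) by simp
      then have "\<theta> * Q * X\<^sup>2 * (3 / 4 * \<kappa>) \<le> \<theta> * Q * X\<^sup>2 * (\<kappa> - \<theta> * q * (Q / t))"
        using \<theta>p pos by (intro mult_left_mono) auto
      then show ?thesis
        by (simp add: X_def power2_norm_eq_inner mult_ac)
    qed
    have T5: "- (\<theta> * (Q * S) * (gf (x t) \<bullet> (x t - y) + \<nu> \<bullet> A (x t - y) + e * (x t \<bullet> (x t - y))))
        \<le> - (\<theta> * (Q * S) * \<phi>) - 1 / 2 * (H * V\<^sup>2)"
    proof -
      have "\<theta> * (Q * S) * (\<phi> + e / 2 * V\<^sup>2)
          \<le> \<theta> * (Q * S) * (gf (x t) \<bullet> (x t - y) + \<nu> \<bullet> A (x t - y) + e * (x t \<bullet> (x t - y)))"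
        using \<theta>p pos gap_le_grad[OF t(2), of y \<nu>]
        by (intro mult_left_mono) (auto simp: \<phi>_def e_def V_def)
      then show ?thesis by (simp add: H_def algebra_simps)
    qed
    have T6: "- (\<theta> * (Q * S) * e * ((l t - \<nu>) \<bullet> (l t - \<nu>))) = - (H * U\<^sup>2)"
      by (simp add: H_def U_def power2_norm_eq_inner)
    have L1: "Z * (1 + \<kappa>) / t * V \<le> 1 / 8 * (H * V\<^sup>2) + G"
    proof -
      have "Z * (1 + \<kappa>) / t * V \<le> H / 8 * V\<^sup>2 + (Z * (1 + \<kappa>) / t)\<^sup>2 / (4 * (H / 8))"
        by (rule young_linear) (use H in auto)
      also have "(Z * (1 + \<kappa>) / t)\<^sup>2 / (4 * (H / 8))
          = 2 * (Z * (1 + \<kappa>))\<^sup>2 / (\<theta> * c) * (P / (Q * S * (t * t)))"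
        by (simp add: H_def e power_divide power2_eq_square[of t] mult_ac)
      also have "\<dots> \<le> G" using ev(7) by simp
      finally show ?thesis by simp
    qed
    have L2: "Z * \<theta>\<^sup>2 * K * (Q * Q * S / t) * V \<le> 1 / 8 * (H * V\<^sup>2) + G"
    proof -
      have "Z * \<theta>\<^sup>2 * K * (Q * Q * S / t) * V
          \<le> H / 8 * V\<^sup>2 + (Z * \<theta>\<^sup>2 * K * (Q * Q * S / t))\<^sup>2 / (4 * (H / 8))"
        by (rule young_linear) (use H in auto)
      also have "(Z * \<theta>\<^sup>2 * K * (Q * Q * S / t))\<^sup>2 / (4 * (H / 8))
          = 2 * (Z * \<theta>\<^sup>2 * K)\<^sup>2 / (\<theta> * c) * (P * Q * Q * Q * S / (t * t))"
        using pos \<theta>p c by (simp add: H_def e power2_eq_square mult_ac)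
      also have "\<dots> \<le> G" using ev(8) by simp
      finally show ?thesis by simp
    qed
    have L3: "Z * \<theta> / t * U \<le> 1 / 4 * (H * U\<^sup>2) + G"
    proof -
      have "Z * \<theta> / t * U \<le> H / 4 * U\<^sup>2 + (Z * \<theta> / t)\<^sup>2 / (4 * (H / 4))"
        by (rule young_linear) (use H in auto)
      also have "(Z * \<theta> / t)\<^sup>2 / (4 * (H / 4)) = (Z * \<theta>)\<^sup>2 / (\<theta> * c) * (P / (Q * S * (t * t)))"
        by (simp add: H_def e power_divide power2_eq_square[of t] mult_ac)
      also have "\<dots> \<le> G" using ev(9) by simp
      finally show ?thesis by simp
    qed
    have L4: "Z * \<theta> * (Q / t) * X \<le> 1 / 4 * (\<theta> * \<kappa> * Q * X\<^sup>2) + G"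
    proof -
      have "Z * \<theta> * (Q / t) * X
          \<le> \<theta> * \<kappa> * Q / 4 * X\<^sup>2 + (Z * \<theta> * (Q / t))\<^sup>2 / (4 * (\<theta> * \<kappa> * Q / 4))"
        by (rule young_linear) (use \<theta>p \<kappa>p pos in auto)
      also have "(Z * \<theta> * (Q / t))\<^sup>2 / (4 * (\<theta> * \<kappa> * Q / 4)) = (Z * \<theta>)\<^sup>2 / (\<theta> * \<kappa>) * (Q / (t * t))"
        using pos \<theta>p \<kappa>p by (simp add: power2_eq_square mult_ac)
      also have "\<dots> \<le> G" using ev(10) by simp
      finally show ?thesis by simp
    qed
    have D: "Z / t * drift y \<nu> t \<le> Z * (1 + \<kappa>) / t * V + Z * \<theta> * (Q / t) * X + Z * \<theta> / t * U
        + Z * \<theta>\<^sup>2 * K * (Q * Q * S / t) * V"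
    proof -
      have "Z / t * drift y \<nu> t
          \<le> Z / t * (V + \<theta> * Q * X + \<kappa> * V + \<theta> * U + \<theta>\<^sup>2 * (Q * Q * S) * (K * V))"
        unfolding drift_def pw2 K_def[symmetric] Q_def[symmetric] u_def[symmetric] V_def[symmetric]
          U_def[symmetric]
        using norm_u Z0 t by (intro mult_left_mono add_right_mono) auto
      also have "\<dots> = Z * (1 + \<kappa>) / t * V + Z * \<theta> * (Q / t) * X + Z * \<theta> / t * U
          + Z * \<theta>\<^sup>2 * K * (Q * Q * S / t) * V"
        using t by (simp add: field_simps)
      finally show ?thesis .
    qed
    have E: "\<rho> / Q * energy y \<nu> t \<le> 1 / 4 * (\<theta> * (Q * S) * \<phi>) + 1 / 8 * (H * V\<^sup>2)
        + 1 / 4 * (\<theta> * \<kappa> * Q * X\<^sup>2) + 1 / 4 * (H * U\<^sup>2)"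
    proof -
      have "energy y \<nu> t = \<theta>\<^sup>2 * (Q * Q * S) * \<phi> + u \<bullet> u / 2 + \<kappa> / 2 * V\<^sup>2 + \<theta> / 2 * U\<^sup>2"
        by (simp only: energy_def pw2 Q_def u_def V_def U_def \<phi>_def power2_norm_eq_inner)
      also have "\<dots> \<le> \<theta>\<^sup>2 * (Q * Q * S) * \<phi> + (1 + \<kappa> / 2) * V\<^sup>2 + (\<theta> * Q * X)\<^sup>2 + \<theta> / 2 * U\<^sup>2"
        using uu by (simp add: algebra_simps)
      finally have "\<rho> / Q * energy y \<nu> t \<le> \<rho> / Q *
          (\<theta>\<^sup>2 * (Q * Q * S) * \<phi> + (1 + \<kappa> / 2) * V\<^sup>2 + (\<theta> * Q * X)\<^sup>2 + \<theta> / 2 * U\<^sup>2)"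
        using pos \<rho>(1) by (intro mult_left_mono) auto
      also have "\<dots> = \<rho> * \<theta> * (\<theta> * (Q * S) * \<phi>) + (1 + \<kappa> / 2) * \<rho> * (1 / Q) * V\<^sup>2
          + \<rho> * \<theta> * (\<theta> * Q * X\<^sup>2) + \<theta> * \<rho> / 2 * (1 / Q) * U\<^sup>2"
        using pos by (simp add: power2_eq_square field_simps)
      also have "\<dots> \<le> 1 / 4 * (\<theta> * (Q * S) * \<phi>) + \<theta> * c / 8 * (Q * S / P) * V\<^sup>2
          + \<kappa> / 4 * (\<theta> * Q * X\<^sup>2) + \<theta> * c / 4 * (Q * S / P) * U\<^sup>2"
        using ev(3,4) \<rho> \<phi> pos \<theta>p by (intro add_mono mult_right_mono) auto
      also have "\<dots> = 1 / 4 * (\<theta> * (Q * S) * \<phi>) + 1 / 8 * (H * V\<^sup>2)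
          + 1 / 4 * (\<theta> * \<kappa> * Q * X\<^sup>2) + 1 / 4 * (H * U\<^sup>2)"
        by (simp add: H_def e mult_ac)
      finally show ?thesis .
    qed
    have "0 \<le> \<theta> * (Q * S) * \<phi>" "0 \<le> H * U\<^sup>2"
      using \<theta>p pos \<phi> H by auto
    moreover have "energy_rate y \<nu> t
        = \<theta>\<^sup>2 * (2 * q + s) * (Q * Q * S / t) * \<phi>
        + - (\<theta>\<^sup>2 * (Q * Q * S) * (p * e / t / 2) * (x t \<bullet> x t - y \<bullet> y))
        + \<theta> * q * (Q / t) * ((x t - y) \<bullet> x' t)
        + - (\<theta> * Q * (\<kappa> - \<theta> * q * (Q / t)) * (x' t \<bullet> x' t))
        + - (\<theta> * (Q * S) * (gf (x t) \<bullet> (x t - y) + \<nu> \<bullet> A (x t - y) + e * (x t \<bullet> (x t - y))))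
        + - (\<theta> * (Q * S) * e * ((l t - \<nu>) \<bullet> (l t - \<nu>)))"
      unfolding energy_rate_def Q_def S_def \<phi>_def e_def by linarith
    ultimately have "energy_rate y \<nu> t + Z / t * drift y \<nu> t \<le> 5 * G - \<rho> / Q * energy y \<nu> t"
      using T1 T2 T3 T4 T5 T6 D L1 L2 L3 L4 E by linarith
    then show ?case
      by (simp only: y_def \<nu>_def G_def Q_def)
  qed
qed


section \<open>Continuity along the flow and the first-crossing bound\<close>

lemma continuous_on_f: "continuous_on UNIV f"
  using grad unfolding gderiv_def
  by (metis has_derivative_continuous continuous_at_imp_continuous_on)

lemma continuous_on_reg:
  "continuous_on {t0..} xt" "continuous_on {t0..} lt"
proof -
  have lip: "norm ((xt t, lt t) - (xt r, lt r)) \<le> Z / t0 * (t - r)" if "t0 \<le> r" "r \<le> t" for r t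
  proof -
    have "(t - r) / r * Z \<le> (t - r) / t0 * Z"
      using that t0 by (intro mult_right_mono divide_left_mono) (auto simp: Z_def)
    then show ?thesis using reg_lipschitz[OF that] by (simp add: mult.commute)
  qed
  have "(Z / t0)-lipschitz_on {t0..} (\<lambda>t. (xt t, lt t))"
  proof (rule lipschitz_onI)
    fix r t assume "r \<in> {t0..}" "t \<in> {t0..}"
    then show "dist (xt r, lt r) (xt t, lt t) \<le> Z / t0 * dist r t"
      using lip[of r t] lip[of t r]
      by (cases "r \<le> t") (auto simp: dist_norm norm_minus_commute simp del: diff_Pair)
  qed (use t0 in \<open>simp add: Z_def\<close>)
  then have "continuous_on {t0..} (\<lambda>t. (xt t, lt t))"
    by (rule lipschitz_on_continuous_on)
  from continuous_on_fst[OF this] continuous_on_snd[OF this]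
  show "continuous_on {t0..} xt" "continuous_on {t0..} lt" by simp_all
qed

lemma continuous_on_flow:
  assumes "T > t0"
  shows "continuous_on {T..} x" "continuous_on {T..} x'" "continuous_on {T..} l"
  using assms
  by (auto intro!: continuous_at_imp_continuous_on has_vector_derivative_continuous[OF x_deriv]
      has_vector_derivative_continuous[OF x'_deriv] has_vector_derivative_continuous[OF l_deriv])

lemma continuous_on_energy:
  assumes "T > t0"
  shows "continuous_on {T..} (\<lambda>t. energy (xt t) (lt t) t)"
proof -
  have sub: "{T..} \<subseteq> {t0..}" using assms by auto
  note cont = continuous_on_flow[OF assms] continuous_on_subset[OF continuous_on_reg(1) sub]
    continuous_on_subset[OF continuous_on_reg(2) sub]
  note f = continuous_on_compose2[OF continuous_on_f _ subset_UNIV]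
  have "continuous_on {T..} (\<lambda>t. t powr r)" for r
    using assms t0 by (intro continuous_intros) auto
  then show ?thesis
    unfolding energy_def gap_def eps_def using assms t0
    by (intro continuous_intros cont f A.continuous_on) auto
qed

lemma isCont_drift:
  assumes "t > t0"
  shows "isCont (drift y \<nu>) t"
proof -
  have "isCont x t" "isCont x' t" "isCont l t"
    using x_deriv x'_deriv l_deriv assms by (auto intro: has_vector_derivative_continuous)
  then show ?thesis
    unfolding drift_def [abs_def] using assms t0 by (intro continuous_intros) auto
qed

text \<open>Compare \<open>E\<close> with \<open>M * t powr w\<close>. If they meet at
  \<open>t\<close>, the lower bound frozen at \<open>t\<close> touches zero there with negative
  slope, hence is positive just before; as it lies below the true difference, \<open>E\<close> was
  above the comparison function already earlier.\<close>

lemma energy_upper_bound: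
  "\<exists>M>0. eventually (\<lambda>t. energy (xt t) (lt t) t \<le> M * t powr (3 * q + s - 1)) at_top"
proof -
  \<comment> \<open>The exponent at which the damping \<open>\<rho> / t powr q * t powr w\<close>
    balances the source \<open>t powr (2 * q + s - 1)\<close>.\<close>
  define w where "w = 3 * q + s - 1"
  define E where "E t = energy (xt t) (lt t) t" for t
  have "eventually (\<lambda>t. - w * t powr (w - 1) \<le> \<rho> / 2 * t powr (w - q)) at_top"
    using q \<rho>(1) by (intro powr_dominated) auto
  with dissipation have "eventually (\<lambda>t. energy_rate (xt t) (lt t) t + Z / t * drift (xt t) (lt t) t
      \<le> 5 * t powr (w - q) - \<rho> / t powr q * E t \<and>
      - w * t powr (w - 1) \<le> \<rho> / 2 * t powr (w - q)) at_top"
    by eventually_elim (simp add: w_def E_def algebra_simps)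
  then obtain T0 where T0: "\<And>t. t \<ge> T0 \<Longrightarrow>
      energy_rate (xt t) (lt t) t + Z / t * drift (xt t) (lt t) t
        \<le> 5 * t powr (w - q) - \<rho> / t powr q * E t"
      "\<And>t. t \<ge> T0 \<Longrightarrow> - w * t powr (w - 1) \<le> \<rho> / 2 * t powr (w - q)"
    unfolding eventually_at_top_linorder by blast
  define T where "T = max T0 (t0 + 1)"
  have T: "T \<ge> T0" "T > t0" "T > 0" using t0 by (auto simp: T_def)
  \<comment> \<open>At a crossing the slope is at most \<open>5 - M * \<rho> / 2\<close> times
    \<open>t powr (w - q)\<close>, so any value of \<open>M * \<rho>\<close> above 10 suffices. The
    second summand lifts the comparison function above \<open>E\<close> at \<open>T\<close>.\<close>
  define M where "M = 11 / \<rho> + \<bar>E T\<bar> / T powr w"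
  have M: "M > 0" "M * \<rho> \<ge> 11"
  proof -
    show "M > 0" using \<rho>(1) by (simp add: M_def add_pos_nonneg)
    have "11 / \<rho> * \<rho> \<le> M * \<rho>"
      using \<rho>(1) by (intro mult_right_mono) (auto simp: M_def)
    then show "M * \<rho> \<ge> 11" using \<rho>(1) by simp
  qed
  have "E t - M * t powr w < 0" if "T \<le> t" for t
  proof (rule negative_if_no_upcrossing[OF _ _ _ that])
    show "continuous_on {T..} (\<lambda>t. E t - M * t powr w)"
      unfolding E_def using T t0 by (intro continuous_intros continuous_on_energy) auto
    have "M * T powr w = 11 / \<rho> * T powr w + \<bar>E T\<bar>"
      using T by (simp add: M_def distrib_right)
    moreover have "11 / \<rho> * T powr w > 0" using T \<rho>(1) by simp
    ultimately show "E T - M * T powr w < 0" by linarith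
  next
    fix t assume t: "T < t" and "E t - M * t powr w = 0"
    then have Et: "E t = M * t powr w" and pos: "t > t0" "t > 0" "t \<ge> T0" using T t0 by auto
    define d where "d = drift (xt t) (lt t)"
    define h where "h r = energy (xt t) (lt t) r - (t - r) / r * Z * d r - M * r powr w" for r
    \<comment> \<open>The drift contains norms and need not be differentiable. Since its factor
      vanishes at \<open>r = t\<close>, continuity suffices by Caratheodory's characterization of
      the derivative.\<close>
    have rest: "((\<lambda>r. (t - r) / r * Z * d r) has_real_derivative - (Z / t * d t)) (at t)"
      unfolding CARAT_DERIV
    proof (intro exI[of _ "\<lambda>r. - (1 / r * Z * d r)"] conjI allI)
      show "isCont (\<lambda>r. - (1 / r * Z * d r)) t"
        unfolding d_def using pos by (intro continuous_intros isCont_drift) auto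
    qed (simp_all add: algebra_simps diff_divide_distrib)
    have "((\<lambda>r. M * r powr w) has_real_derivative M * (w * t powr (w - 1))) (at t)"
      using pos by (intro DERIV_cmult has_real_derivative_powr)
    moreover have "A (xt t) - b = eps t *\<^sub>R lt t"
      using reg_l[of t] pos by (simp add: eps_def)
    ultimately have h': "(h has_real_derivative
        energy_rate (xt t) (lt t) t - - (Z / t * d t) - M * (w * t powr (w - 1))) (at t)"
      unfolding h_def [abs_def] using pos by (intro DERIV_diff rest energy_deriv)
    have "\<rho> / t powr q * E t = M * \<rho> * t powr (w - q)"
      using pos by (simp add: Et powr_diff)
    then have "energy_rate (xt t) (lt t) t + Z / t * d t
        \<le> 5 * t powr (w - q) - M * \<rho> * t powr (w - q)"
      using T0(1)[OF pos(3)] by (simp add: d_def)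
    moreover have "M * (- w * t powr (w - 1)) \<le> M * (\<rho> / 2 * t powr (w - q))"
      using T0(2)[OF pos(3)] M by (intro mult_left_mono) auto
    moreover have "11 * t powr (w - q) \<le> M * \<rho> * t powr (w - q)"
      using M by (intro mult_right_mono) auto
    moreover have "0 < t powr (w - q)" using pos by simp
    ultimately have "energy_rate (xt t) (lt t) t - - (Z / t * d t) - M * (w * t powr (w - 1)) < 0"
      by (simp only: minus_mult_left[symmetric] minus_mult_right[symmetric] times_divide_eq_left)
    from DERIV_neg_dec_left[OF h' this] obtain e where
      e: "e > 0" "\<And>k. 0 < k \<Longrightarrow> k < e \<Longrightarrow> h t < h (t - k)" by blast
    \<comment> \<open>A step back short enough for the slope to decide the sign, and never beyond
      \<open>T\<close>.\<close>
    define r where "r = t - min (e / 2) (t - T)"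
    have r: "T \<le> r" "r < t" using e t by (auto simp: r_def)
    have "h t < h r" unfolding r_def using e t by (intro e(2)) auto
    moreover have "h t = 0" using Et by (simp add: h_def E_def)
    moreover have "h r \<le> E r - M * r powr w"
    proof -
      have d0: "d r \<ge> 0"
        unfolding d_def drift_def using \<theta>_pos \<kappa>_pos onorm_pos_le[OF bl_A] by (intro add_nonneg_nonneg) auto
      have "norm ((xt t, lt t) - (xt r, lt r)) * d r \<le> (t - r) / r * Z * d r"
        using r T by (intro mult_right_mono[OF reg_lipschitz d0]) auto
      moreover have "energy (xt t) (lt t) r - norm ((xt t, lt t) - (xt r, lt r)) * d r \<le> E r"
        unfolding E_def d_def using r T t by (intro energy_unfreeze) auto
      ultimately show ?thesis by (simp only: h_def)
    qed
    ultimately show "\<exists>r\<in>{T..<t}. 0 \<le> E r - M * r powr w"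
      using r by (intro bexI[of _ r]) auto
  qed
  then show ?thesis
    using M(1) unfolding w_def E_def eventually_at_top_linorder
    by (metis diff_less_0_iff_less less_imp_le)
qed

section \<open>Rates for the gap, the distance to the path, the values and the feasibility\<close>

lemma gap_upper_bound:
  "\<exists>M>0. eventually (\<lambda>t. gap (xt t) (lt t) t \<le> M * t powr (q - 1)) at_top"
proof -
  obtain M where M: "M > 0"
    and ev: "eventually (\<lambda>t. energy (xt t) (lt t) t \<le> M * t powr (3 * q + s - 1)) at_top"
    using energy_upper_bound by blast
  have "eventually (\<lambda>t. gap (xt t) (lt t) t \<le> M / \<theta>\<^sup>2 * t powr (q - 1)) at_top"
    using ev eventually_gt_at_top[of t0]
  proof eventually_elim
    case (elim t)
    then have t: "t > 0" using t0 by simp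
    have "\<theta>\<^sup>2 * t powr (2 * q + s) * gap (xt t) (lt t) t \<le> energy (xt t) (lt t) t"
      unfolding energy_def using \<theta>_pos \<kappa>_pos by simp
    also have "\<dots> \<le> M * t powr (3 * q + s - 1)" by (rule elim)
    \<comment> \<open>Dividing by the weight of the gap in the energy leaves the exponent
      \<open>q - 1\<close>; the other summands of the energy are nonnegative.\<close>
    also have "t powr (3 * q + s - 1) = t powr (2 * q + s) * t powr (q - 1)"
    proof -
      have "3 * q + s - 1 = (2 * q + s) + (q - 1)" by simp
      then show ?thesis by (simp only: powr_add)
    qed
    finally have "t powr (2 * q + s) * (\<theta>\<^sup>2 * gap (xt t) (lt t) t)
        \<le> t powr (2 * q + s) * (M * t powr (q - 1))"
      by (simp only: mult_ac)
    then have "\<theta>\<^sup>2 * gap (xt t) (lt t) t \<le> M * t powr (q - 1)"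
      using t by (simp only: mult_le_cancel_left_pos powr_gt_zero)
    then show ?case
      using \<theta>_pos by (simp add: field_simps)
  qed
  then show ?thesis
    using M \<theta>_pos by (intro exI[of _ "M / \<theta>\<^sup>2"]) auto
qed

text \<open>Everything passes through \<open>xt t\<close>. The distance to it is controlled by the
  gap divided by \<open>eps t / 2\<close>, while \<open>xt t\<close> itself misses the optimal value
  and the constraint by a multiple of \<open>eps t\<close>, which is the source of the term
  \<open>1 / t powr p\<close>.\<close>

lemma convergence_rates:
  "\<exists>C>0. eventually (\<lambda>t. (norm (x t - xt t))\<^sup>2 \<le> C * (1 / t powr (1 - (p + q))) \<and>
    \<bar>f (x t) - f xs\<bar> \<le> C * (1 / t powr p + 1 / t powr ((1 - (p + q)) / 2)) \<and>
    norm (A (x t) - b) \<le> C * (1 / t powr p + 1 / t powr ((1 - (p + q)) / 2))) at_top"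
proof -
  obtain M where M: "M > 0"
    and ev: "eventually (\<lambda>t. gap (xt t) (lt t) t \<le> M * t powr (q - 1)) at_top"
    using gap_upper_bound by blast
  define K where "K = onorm A"
  have K: "K \<ge> 0" unfolding K_def by (rule onorm_pos_le[OF bl_A])
  have Z0: "Z \<ge> 0" by (simp add: Z_def)
  define N where "N = 2 * M / c"
  define D where "D = sqrt N"
  have N: "N > 0" "D > 0" using M c by (simp_all add: N_def D_def)
  define C where "C = N + (M + (Z * K + c * Z) * D + 2 * c * Z\<^sup>2) + (K * D + c * Z)"
  have C: "N \<le> C" "M + (Z * K + c * Z) * D + 2 * c * Z\<^sup>2 \<le> C" "K * D + c * Z \<le> C"
    using N M K Z0 c by (auto simp: C_def)
  have "eventually (\<lambda>t. (norm (x t - xt t))\<^sup>2 \<le> C * (1 / t powr (1 - (p + q))) \<and>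
    \<bar>f (x t) - f xs\<bar> \<le> C * (1 / t powr p + 1 / t powr ((1 - (p + q)) / 2)) \<and>
    norm (A (x t) - b) \<le> C * (1 / t powr p + 1 / t powr ((1 - (p + q)) / 2))) at_top"
    using ev eventually_gt_at_top[of t0] eventually_ge_at_top[of 1]
  proof eventually_elim
    case (elim t)
    have t: "t > 0" "t \<ge> t0" using elim t0 by auto
    define e where "e = eps t"
    define a where "a = 1 / t powr p"
    define g where "g = 1 / t powr ((1 - (p + q)) / 2)"
    define \<delta> where "\<delta> = norm (x t - xt t)"
    have ag: "a > 0" "g > 0" using t by (auto simp: a_def g_def)
    have ea: "e = c * a" by (simp add: e_def eps_def a_def)
    have e: "e > 0" using ag c ea by simp
    have "a \<le> 1"
      using elim p by (simp add: a_def ge_one_powr_ge_zero)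
    then have ec: "e \<le> c" using c by (simp add: ea)
    have g2: "g\<^sup>2 = 1 / t powr (1 - (p + q))"
    proof -
      have "t powr ((1 - (p + q)) / 2) * t powr ((1 - (p + q)) / 2) = t powr (1 - (p + q))"
        unfolding powr_add[symmetric] by (simp only: field_sum_of_halves)
      then show ?thesis
        unfolding g_def power_divide power_one by (simp only: power2_eq_square)
    qed
    \<comment> \<open>The gap rate factors into the size of \<open>eps t\<close> and the squared
      rate of the distance, so \<open>a\<close> cancels against strong convexity.\<close>
    have "t powr (q - 1) = a * g\<^sup>2"
    proof -
      have "t powr (q - 1) = t powr (- p + - (1 - (p + q)))" by simp
      then show ?thesis
        unfolding powr_add g2 a_def powr_minus_divide .
    qed
    then have gap: "gap (xt t) (lt t) t \<le> M * (a * g\<^sup>2)" using elim(1) by simp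
    have "e / 2 * \<delta>\<^sup>2 \<le> M * (a * g\<^sup>2)"
      using gap_ge[OF t(2)] gap by (simp add: e_def \<delta>_def)
    then have "a * (\<delta>\<^sup>2 * (c / 2)) \<le> a * (M * g\<^sup>2)"
      by (simp add: ea mult_ac)
    then have "\<delta>\<^sup>2 * (c / 2) \<le> M * g\<^sup>2"
      using ag(1) by (simp only: mult_le_cancel_left_pos)
    then have \<delta>2: "\<delta>\<^sup>2 \<le> N * g\<^sup>2"
      using c by (simp add: N_def field_simps)
    also have "\<dots> = (D * g)\<^sup>2"
      unfolding D_def power_mult_distrib real_sqrt_pow2[OF less_imp_le[OF N(1)]] ..
    finally have \<delta>: "\<delta> \<le> D * g"
      by (rule power2_le_imp_le) (use N(2) ag(2) in simp)
    \<comment> \<open>In the estimate of the values the gap itself is of lower order, because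
      \<open>a\<close> and \<open>g\<close> are at most 1 for \<open>t \<ge> 1\<close>.\<close>
    have gapg: "M * (a * g\<^sup>2) \<le> M * g"
    proof -
      have "g \<le> 1" using elim p by (simp add: g_def ge_one_powr_ge_zero)
      then have "a * g \<le> 1" using \<open>a \<le> 1\<close> ag by (intro mult_le_one) auto
      then have "g * (a * g) \<le> g * 1" using ag by (intro mult_left_mono) auto
      then show ?thesis using M by (intro mult_left_mono) (auto simp: power2_eq_square mult_ac)
    qed
    have nx: "norm (xt t) \<le> Z" and nl: "norm (lt t) \<le> Z"
      using norm_xt_le[OF t(2)] norm_lt_le[OF t(2)] .
    have ns: "norm xs \<le> Z" "norm ls \<le> Z"
      using norm_fst_le[of xs ls] norm_snd_le[of ls xs] by (simp_all add: Z_def)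
    \<comment> \<open>Stated over a fresh type because it is applied to primal and to dual
      vectors.\<close>
    have inner_Z: "\<bar>y \<bullet> z\<bar> \<le> Z\<^sup>2" if "norm y \<le> Z" "norm z \<le> Z" for y z :: "'d::real_inner"
    proof -
      have "norm y * norm z \<le> Z * Z" using that Z0 by (intro mult_mono) auto
      then show ?thesis
        using Cauchy_Schwarz_ineq2[of y z] by (simp add: power2_eq_square)
    qed
    have nA: "norm (A (x t - xt t)) \<le> K * \<delta>"
      unfolding K_def \<delta>_def by (rule onorm[OF bl_A])
    have Axt: "A (xt t) - b = e *\<^sub>R lt t"
      using reg_l[OF t(2)] by (simp add: e_def eps_def)
    have feas: "norm (A (x t) - b) \<le> K * D * g + c * Z * a"
    proof -
      have "norm (A (x t) - b) = norm (A (x t - xt t) + e *\<^sub>R lt t)"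
        unfolding Axt[symmetric] by (simp add: A.diff)
      also have "\<dots> \<le> norm (A (x t - xt t)) + norm (e *\<^sub>R lt t)"
        by (rule norm_triangle_ineq)
      also have "\<dots> \<le> K * (D * g) + c * a * Z"
        using nA mult_left_mono[OF \<delta> K] nl e mult_left_mono[OF nl, of e] by (simp add: ea)
      finally show ?thesis by (simp add: mult_ac)
    qed
    have lA: "\<bar>lt t \<bullet> A (x t - xt t)\<bar> \<le> Z * K * \<delta>"
    proof -
      have "norm (lt t) * norm (A (x t - xt t)) \<le> Z * (K * \<delta>)"
        using nl nA Z0 by (intro mult_mono) auto
      then show ?thesis
        using Cauchy_Schwarz_ineq2[of "lt t" "A (x t - xt t)"] by simp
    qed
    have xA: "\<bar>e * (xt t \<bullet> (x t - xt t))\<bar> \<le> c * Z * \<delta>"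
    proof -
      have "\<bar>xt t \<bullet> (x t - xt t)\<bar> \<le> Z * \<delta>"
        using Cauchy_Schwarz_ineq2[of "xt t" "x t - xt t"] mult_right_mono[OF nx, of \<delta>]
        by (simp add: \<delta>_def)
      then have "e * \<bar>xt t \<bullet> (x t - xt t)\<bar> \<le> c * (Z * \<delta>)"
        using ec e by (intro mult_mono) auto
      then show ?thesis using e by (simp add: abs_mult)
    qed
    \<comment> \<open>The upper estimate solves the definition of the gap for
      \<open>f (x t)\<close>, dropping the square of \<open>x t\<close>, which has the favourable
      sign; the lower estimate \<open>low1\<close> uses the tangent at \<open>xt t\<close>.\<close>
    have up1: "f (x t) - f (xt t) \<le> M * g + Z * K * \<delta> + e * Z\<^sup>2"
    proof -
      have "f (x t) - f (xt t) = gap (xt t) (lt t) t - lt t \<bullet> A (x t - xt t)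
          - e / 2 * (x t \<bullet> x t) + e / 2 * (xt t \<bullet> xt t)"
        by (simp add: gap_def e_def algebra_simps)
      moreover have "e / 2 * (xt t \<bullet> xt t) \<le> e / 2 * Z\<^sup>2"
        using inner_Z[OF nx nx] e by (intro mult_left_mono) auto
      moreover have "0 \<le> e / 2 * (x t \<bullet> x t)" "0 \<le> e / 2 * Z\<^sup>2" using e by auto
      moreover have "e * Z\<^sup>2 = e / 2 * Z\<^sup>2 + e / 2 * Z\<^sup>2" by simp
      ultimately show ?thesis using gap gapg lA by linarith
    qed
    have low1: "- (Z * K * \<delta>) - c * Z * \<delta> \<le> f (x t) - f (xt t)"
    proof -
      have "f (xt t) + gf (xt t) \<bullet> (x t - xt t) \<le> f (x t)"
        by (rule convex_gradient_ineq[OF convex grad])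
      moreover have "gf (xt t) \<bullet> (x t - xt t) + lt t \<bullet> A (x t - xt t) + e * (xt t \<bullet> (x t - xt t)) = 0"
        using reg_x[OF t(2)] by (simp only: e_def eps_def)
      ultimately show ?thesis using lA xA by linarith
    qed
    have Axs: "A (xt t - xs) = e *\<^sub>R lt t"
      using Axt sol_l by (simp add: A.diff)
    have up2: "f (xt t) - f xs \<le> e * Z\<^sup>2"
    proof -
      have "f (xt t) + gf (xt t) \<bullet> (xs - xt t) \<le> f xs"
        by (rule convex_gradient_ineq[OF convex grad])
      moreover have "gf (xt t) \<bullet> (xs - xt t) = - (gf (xt t) \<bullet> (xt t - xs))"
        by (simp add: inner_diff_right)
      moreover have "gf (xt t) \<bullet> (xt t - xs)
          = - (e * (lt t \<bullet> lt t)) - e * (xt t \<bullet> xt t) + e * (xt t \<bullet> xs)"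
        using reg_x[OF t(2), of "xt t - xs"] unfolding Axs
        by (simp add: e_def eps_def inner_diff_right algebra_simps)
      moreover have "e * (xt t \<bullet> xs) \<le> e * Z\<^sup>2"
        using inner_Z[OF nx ns(1)] e by (intro mult_left_mono) auto
      moreover have "0 \<le> e * (lt t \<bullet> lt t)" "0 \<le> e * (xt t \<bullet> xt t)" using e by auto
      ultimately show ?thesis by linarith
    qed
    have low2: "- (e * Z\<^sup>2) \<le> f (xt t) - f xs"
    proof -
      have "f xs + gf xs \<bullet> (xt t - xs) \<le> f (xt t)"
        by (rule convex_gradient_ineq[OF convex grad])
      moreover have "gf xs \<bullet> (xt t - xs) = - (e * (ls \<bullet> lt t))"
        using sol_x[of "xt t - xs"] unfolding Axs by simp
      moreover have "e * (ls \<bullet> lt t) \<le> e * Z\<^sup>2"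
        using inner_Z[OF ns(2) nl] e by (intro mult_left_mono) auto
      ultimately show ?thesis by linarith
    qed
    have "Z * K * \<delta> + c * Z * \<delta> \<le> (Z * K + c * Z) * D * g"
      using mult_left_mono[OF \<delta>, of "Z * K + c * Z"] K Z0 c by (simp add: algebra_simps)
    moreover have "0 \<le> c * Z * \<delta>" "0 \<le> M * g" "0 \<le> e * Z\<^sup>2"
      using c Z0 M ag e by (auto simp: \<delta>_def)
    moreover have "2 * (e * Z\<^sup>2) = 2 * c * Z\<^sup>2 * a" by (simp add: ea)
    ultimately have "\<bar>f (x t) - f xs\<bar> \<le> M * g + (Z * K + c * Z) * D * g + 2 * c * Z\<^sup>2 * a"
      using up1 up2 low1 low2 by linarith
    also have "\<dots> \<le> (M + (Z * K + c * Z) * D + 2 * c * Z\<^sup>2) * (a + g)"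
    proof -
      have "0 \<le> (M + (Z * K + c * Z) * D) * a" "0 \<le> 2 * c * Z\<^sup>2 * g"
        using M K Z0 c N ag by auto
      then show ?thesis by (simp add: algebra_simps)
    qed
    also have "\<dots> \<le> C * (a + g)"
      using C(2) ag by (intro mult_right_mono) auto
    finally have fb: "\<bar>f (x t) - f xs\<bar> \<le> C * (a + g)" .
    have "K * D * g + c * Z * a \<le> (K * D + c * Z) * (a + g)"
    proof -
      have "0 \<le> K * D * a" "0 \<le> c * Z * g" using K N c Z0 ag by auto
      then show ?thesis by (simp add: algebra_simps)
    qed
    also have "\<dots> \<le> C * (a + g)"
      using C(3) ag by (intro mult_right_mono) auto
    finally have Ab: "norm (A (x t) - b) \<le> C * (a + g)"
      using feas by linarith
    have "\<delta>\<^sup>2 \<le> C * g\<^sup>2"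
      using \<delta>2 mult_right_mono[OF C(1), of "g\<^sup>2"] by simp
    then show ?case
      using fb Ab unfolding g2 unfolding a_def g_def \<delta>_def by blast
  qed
  moreover have "C > 0" using C(1) N(1) by linarith
  ultimately show ?thesis by blast
qed

end

section \<open>From the weak formulation to a solution of the system\<close>

lemma le_bigoI:
  assumes "eventually (\<lambda>t. g t \<le> C * h t) at_top" and "C > 0"
  shows "le_bigo t0 g h"
proof -
  obtain T where T: "\<And>t. t \<ge> T \<Longrightarrow> g t \<le> C * h t"
    using assms(1) unfolding eventually_at_top_linorder by blast
  show ?thesis
    unfolding le_bigo_def using assms(2) T by (intro exI[of _ C] conjI exI[of _ "max t0 T"]) auto
qed

theorem theorem3p2:
  fixes f :: "'a::{real_inner,complete_space} \<Rightarrow> real"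
    and gf :: "'a \<Rightarrow> 'a"
    and A :: "'a \<Rightarrow> 'b::{real_inner,complete_space}"
    and b :: 'b
    and t0 \<alpha> \<theta> q p c s :: real
    and x :: "real \<Rightarrow> 'a" and l :: "real \<Rightarrow> 'b"
    and xt :: "real \<Rightarrow> 'a" and lt :: "real \<Rightarrow> 'b"
    and xstar :: 'a and lstar :: 'b
  assumes "convex_on UNIV f"
    and "\<And>y. GDERIV f y :> gf y"
    and "continuous_on UNIV gf"
    and "bounded_linear A"
    and "primal_dual_solutions f A b \<noteq> {}"
    and "t0 > 0" and "\<alpha> > 0" and "\<theta> > 1 / \<alpha>"
    and "0 \<le> q" and "q < 1" and "0 < p" and "p < 1 - q" and "c > 0"
    and "p - 2 * q < s" and "s < 1 - 3 * q"
    and "is_solution gf A b t0 \<alpha> \<theta> q p c s x l"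
    and "\<And>t. t \<ge> t0 \<Longrightarrow> saddle_point (reg_lagrangian f A b c p t) (xt t, lt t)"
    and "is_arg_min norm (\<lambda>z. z \<in> primal_dual_solutions f A b) (xstar, lstar)"
  shows "le_bigo t0 (\<lambda>t. (norm (x t - xt t))\<^sup>2) (\<lambda>t. 1 / t powr (1 - (p + q))) \<and>
    le_bigo t0 (\<lambda>t. lagrangian f A b (x t) lstar - lagrangian f A b xstar lstar)
      (\<lambda>t. 1 / t powr p + 1 / t powr ((1 - (p + q)) / 2)) \<and>
    le_bigo t0 (\<lambda>t. \<bar>f (x t) - f xstar\<bar>)
      (\<lambda>t. 1 / t powr p + 1 / t powr ((1 - (p + q)) / 2)) \<and>
    le_bigo t0 (\<lambda>t. norm (A (x t) - b))
      (\<lambda>t. 1 / t powr p + 1 / t powr ((1 - (p + q)) / 2))"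
proof -
  obtain x' x'' l' where sol: "\<And>t. t \<ge> t0 \<Longrightarrow> (x has_vector_derivative x' t) (at t within {t0..})"
    "\<And>t. t \<ge> t0 \<Longrightarrow> (x' has_vector_derivative x'' t) (at t within {t0..})"
    "\<And>t. t \<ge> t0 \<Longrightarrow> (l has_vector_derivative l' t) (at t within {t0..})"
    "\<And>t. t \<ge> t0 \<Longrightarrow> x'' t + (\<alpha> / t powr q) *\<^sub>R x' t
          + t powr s *\<^sub>R (gf (x t) + adjoint A (l t) + (c / t powr p) *\<^sub>R x t) = 0"
    "\<And>t. t \<ge> t0 \<Longrightarrow> l' t - t powr (q + s) *\<^sub>R
          (A (x t + (\<theta> * t powr q) *\<^sub>R x' t) - b - (c / t powr p) *\<^sub>R l t) = 0"
    using assms(16) unfolding is_solution_def by blast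
  \<comment> \<open>Beyond \<open>t0\<close> the one-sided derivatives are ordinary ones, which is
    why the flow is studied for \<open>t > t0\<close> only.\<close>
  have within: "at t within {t0..} = at t" if "t > t0" for t
    using that by (intro at_within_interior) auto
  have reg: "gf (xt t) \<bullet> v + lt t \<bullet> A v + c / t powr p * (xt t \<bullet> v) = 0"
    "A (xt t) - b = (c / t powr p) *\<^sub>R lt t" if "t \<ge> t0" for t v
  proof -
    have "saddle_point (\<lambda>x l. lagrangian f A b x l
        + c / t powr p / 2 * ((norm x)\<^sup>2 - (norm l)\<^sup>2)) (xt t, lt t)"
      using assms(17)[OF that] by (simp add: saddle_point_def reg_lagrangian_def mult.commute)
    from saddle_point_stationary[OF this assms(4) assms(2)]
    show "gf (xt t) \<bullet> v + lt t \<bullet> A v + c / t powr p * (xt t \<bullet> v) = 0"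
      "A (xt t) - b = (c / t powr p) *\<^sub>R lt t" .
  qed
  \<comment> \<open>The vanishing regularization is written out to match the stationarity lemma with
    \<open>e = 0\<close>.\<close>
  have "saddle_point (\<lambda>x l. lagrangian f A b x l + 0 / 2 * ((norm x)\<^sup>2 - (norm l)\<^sup>2)) (xstar, lstar)"
    using assms(18) by (simp add: is_arg_min_def primal_dual_solutions_def)
  from saddle_point_stationary[OF this assms(4) assms(2)]
  have opt: "gf xstar \<bullet> v + lstar \<bullet> A v = 0" "A xstar = b" for v
    by simp_all
  interpret regularized_flow f gf A b t0 \<alpha> \<theta> q p c s x x' x'' l l' xt lt xstar lstar
  proof (rule regularized_flow.intro)
    fix t w assume t: "t > t0"
    have "(x'' t + (\<alpha> / t powr q) *\<^sub>R x' t
          + t powr s *\<^sub>R (gf (x t) + adjoint A (l t) + (c / t powr p) *\<^sub>R x t)) \<bullet> w = 0"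
      using sol(4)[of t] t by simp
    moreover have "adjoint A (l t) \<bullet> w = l t \<bullet> A w"
      using inner_adjoint_hilbert[OF assms(4), of w "l t"] by (simp add: inner_commute)
    ultimately show "x'' t \<bullet> w + \<alpha> / t powr q * (x' t \<bullet> w)
        + t powr s * (gf (x t) \<bullet> w + l t \<bullet> A w + c / t powr p * (x t \<bullet> w)) = 0"
      by (simp add: inner_add_left)
  next
    fix t assume t: "t > t0"
    show "l' t = t powr (q + s) *\<^sub>R
        (A (x t + (\<theta> * t powr q) *\<^sub>R x' t) - b - (c / t powr p) *\<^sub>R l t)"
      using sol(5)[of t] t by (simp only: right_minus_eq less_imp_le)
    show "(x has_vector_derivative x' t) (at t)" "(x' has_vector_derivative x'' t) (at t)"
      "(l has_vector_derivative l' t) (at t)"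
      using sol(1-3)[of t] within[OF t] t by simp_all
  qed (fact assms opt reg)+
  define B where "B t = 1 / t powr p + 1 / t powr ((1 - (p + q)) / 2)" for t
  obtain C where C: "C > 0" and ev: "eventually (\<lambda>t. (norm (x t - xt t))\<^sup>2 \<le> C * (1 / t powr (1 - (p + q))) \<and>
    \<bar>f (x t) - f xstar\<bar> \<le> C * B t \<and> norm (A (x t) - b) \<le> C * B t) at_top"
    using convergence_rates unfolding B_def by blast
  \<comment> \<open>As \<open>A xstar = b\<close>, the difference is
    \<open>f (x t) - f xstar\<close> plus \<open>lstar \<bullet> (A (x t) - b)\<close>, so the
    bounds for the values and the feasibility combine.\<close>
  have "eventually (\<lambda>t. lagrangian f A b (x t) lstar - lagrangian f A b xstar lstar
      \<le> (C + norm lstar * C) * B t) at_top"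
    using ev
  proof eventually_elim
    case (elim t)
    have "lstar \<bullet> (A (x t) - b) \<le> norm lstar * norm (A (x t) - b)"
      by (rule norm_cauchy_schwarz)
    also have "\<dots> \<le> norm lstar * (C * B t)"
      using elim by (intro mult_left_mono) auto
    finally have "lstar \<bullet> (A (x t) - b) \<le> norm lstar * C * B t" by (simp only: mult.assoc)
    moreover have "f (x t) - f xstar \<le> C * B t" using elim by linarith
    ultimately show ?case
      by (simp add: lagrangian_def opt(2) distrib_right)
  qed
  then have "le_bigo t0 (\<lambda>t. lagrangian f A b (x t) lstar - lagrangian f A b xstar lstar) B"
    by (rule le_bigoI) (use C in \<open>simp add: add_pos_nonneg\<close>)
  moreover note rates = ev[unfolded eventually_conj_iff]
  ultimately show ?thesis
    unfolding B_def[symmetric]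
    by (intro conjI le_bigoI[OF conjunct1[OF rates] C] le_bigoI[OF conjunct1[OF conjunct2[OF rates]] C]
        le_bigoI[OF conjunct2[OF conjunct2[OF rates]] C])
qed

end
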